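(* Let $q>0$, $q\neq1$, and let $l,\lambda\in\mathbb{R}$ with $l\neq0$. The coherent states $|z\rangle_{l,\lambda}$, $z\in\mathbf D_{l,\lambda}$, (i) are normalized eigenvectors of the operator $a$ with eigenvalue $z$, i.e. $a|z\rangle_{l,\lambda}=z|z\rangle_{l,\lambda}$ and ${}_{l,\lambda}\langle z|z\rangle_{l,\lambda}=1$; (ii) are not orthogonal to each other, i.e. ${}_{l,\lambda}\langle z_1|z_2\rangle_{l,\lambda}\neq0$ when $z_1\neq z_2$; (iii) are continuous in their labels $z$; (iv) resolve the unity, i.e. $$\mathbf 1=\int_{\mathbf D_{l,\lambda}}d\mu_{l,\lambda}(\bar z,z)\,|z\rangle_{l,\lambda}\,{}_{l,\lambda}\langle z|,$$ where $$d\mu_{l,\lambda}(\bar z,z)=\frac{1-q}{l^2q^\lambda\ln q^{-1}}\,\frac{\mathcal N_{l,\lambda}(\bar zz)}{\mathcal N_{l,\lambda}(\bar zz/q)}\,\frac{d^2z}{\pi}\qquad\text{if }0<q<1,$$ and $$d\mu_{l,\lambda}(\bar z,z)=\frac{1}{2\pi}\,\frac{d_q^{l,\lambda}x\,d\theta}{1-(q-1)x/(l^2q^\lambda)},\qquad x=|z|^2,\ \theta=\arg(z),$$ with $0<x<\frac{l^2q^\lambda}{q-1}$ and $0\le\theta\le2\pi$, for $q>1$.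
   Context: $\mathcal{F}$ is the Fock space with orthonormal basis $\{|n\rangle:n=0,1,2,\dots\}$ and identity operator $\mathbf 1$; $[n]_q=\frac{1-q^n}{1-q}$, $[0]_q!=1$, $[n]_q!=[n]_q[n-1]_q\cdots[1]_q$. The operator $a$ (annihilation operator of the $(q;l,\lambda)$-deformed Heisenberg algebra $[N,a]=-a$, $[N,a^\dagger]=a^\dagger$, $aa^\dagger-a^\dagger a=l^2q^{-N+\lambda-1}$) acts by $a|n\rangle=\sqrt{l^2q^{\lambda-n}[n]_q}\,|n-1\rangle$ for $n\ge1$ and $a|0\rangle=0$. Coherent states: for $z\in\mathbf D_{l,\lambda}=\{z\in\mathbb{C}:|z|^2<R_{l,\lambda}\}$, with $R_{l,\lambda}=\infty$ if $0<q<1$ and $R_{l,\lambda}=\frac{l^2q^\lambda}{q-1}$ if $q>1$, $$|z\rangle_{l,\lambda}=\mathcal N_{l,\lambda}(|z|^2)^{-1/2}\sum_{n=0}^\infty\frac{q^{n(n+1)/4}z^n}{\sqrt{(l^2q^\lambda)^n[n]_q!}}\,|n\rangle,\qquad \mathcal N_{l,\lambda}(x)=\sum_{n=0}^\infty\frac{q^{n(n+1)/2}x^n}{(l^2q^\lambda)^n[n]_q!}.$$ $d^2z=d(\mathrm{Re}\,z)\,d(\mathrm{Im}\,z)$. For $q>1$, $d_q^{l,\lambda}x$ denotes the $(q;l,\lambda)$-integration $\int_0^{A}f(x)\,d_q^{l,\lambda}x=\frac{q-1}{l^2q^\lambda}A\sum_{k=0}^\infty q^{-k}f(Aq^{-k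})$.
   Formalization: (ii) fails for 0<q<1 (e.g. q=1/2, l=1, λ=0, z1=2, z2=−2), so non-orthogonality is proved exactly when z̄1z2 ≠ −l²q^λ/((1−q)q^k) for all k≥1; for q>1, the integrand in (iv) at the undefined endpoint x=l²q^λ/(q−1) is its left limit. *)

theory Defs
  imports "HOL-Analysis.Analysis"
begin

section \<open>Fock space\<close>

text \<open>
  Fock space is modelled as the space of square-summable complex sequences: a vector is identified
  with its sequence of coordinates in the orthonormal basis of number states. The instantiation of
  \<^class>\<open>real_inner\<close> provides the norm topology; the complex structure is carried by \<open>cscale\<close> and
  by the sesquilinear form \<open>cinner\<close>, which is antilinear in its first argument.
\<close>

definition sq_summable :: "(nat \<Rightarrow> complex) set"
  where "sq_summable = {f. summable (\<lambda>n. (cmod (f n))\<^sup>2)}"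

lemma sq_summable_mult:
  assumes "f \<in> sq_summable" "g \<in> sq_summable"
  shows "summable (\<lambda>n. cnj (f n) * g n)"
proof (rule summable_comparison_test'[where N = 0])
  show "summable (\<lambda>n. (cmod (f n))\<^sup>2 + (cmod (g n))\<^sup>2)"
    using assms unfolding sq_summable_def by (auto intro: summable_add)
  show "norm (cnj (f n) * g n) \<le> (cmod (f n))\<^sup>2 + (cmod (g n))\<^sup>2" for n
  proof -
    have "2 * (cmod (f n) * cmod (g n)) \<le> (cmod (f n))\<^sup>2 + (cmod (g n))\<^sup>2"
      using sum_squares_bound[of "cmod (f n)" "cmod (g n)"] by (simp add: mult.assoc)
    moreover have "0 \<le> cmod (f n) * cmod (g n)" by simp
    ultimately have "cmod (f n) * cmod (g n) \<le> (cmod (f n))\<^sup>2 + (cmod (g n))\<^sup>2" by linarith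
    thus ?thesis by (simp add: norm_mult)
  qed
qed

lemma sq_summable_zero: "(\<lambda>_. 0) \<in> sq_summable"
  by (simp add: sq_summable_def)

lemma sq_summable_scale: "f \<in> sq_summable \<Longrightarrow> (\<lambda>n. c * f n) \<in> sq_summable"
  by (auto simp: sq_summable_def norm_mult power_mult_distrib intro: summable_mult)

lemma sq_summable_add:
  assumes "f \<in> sq_summable" "g \<in> sq_summable"
  shows "(\<lambda>n. f n + g n) \<in> sq_summable"
  unfolding sq_summable_def mem_Collect_eq
proof (rule summable_comparison_test'[where N = 0])
  show "summable (\<lambda>n. 2 * (cmod (f n))\<^sup>2 + 2 * (cmod (g n))\<^sup>2)"
    using assms unfolding sq_summable_def by (auto intro: summable_add summable_mult)
  show "norm ((cmod (f n + g n))\<^sup>2) \<le> 2 * (cmod (f n))\<^sup>2 + 2 * (cmod (g n))\<^sup>2" for n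
  proof -
    have "(cmod (f n + g n))\<^sup>2 \<le> (cmod (f n) + cmod (g n))\<^sup>2"
      by (intro power_mono norm_triangle_ineq norm_ge_zero)
    also have "\<dots> \<le> 2 * (cmod (f n))\<^sup>2 + 2 * (cmod (g n))\<^sup>2"
      using sum_squares_bound[of "cmod (f n)" "cmod (g n)"] by (simp add: power2_sum)
    finally show ?thesis by simp
  qed
qed

lemma sq_summable_finite_support: "(\<lambda>k. if k = n then c else 0) \<in> sq_summable"
proof -
  have "(\<lambda>k. (cmod (if k = n then c else 0))\<^sup>2) = (\<lambda>k. if k = n then (cmod c)\<^sup>2 else 0)"
    by auto
  thus ?thesis by (simp add: sq_summable_def)
qed

typedef fock = sq_summable
  morphisms coord Fock
  using sq_summable_zero by blast

setup_lifting type_definition_fock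

instantiation fock :: real_vector
begin

lift_definition zero_fock :: fock is "\<lambda>_. 0" by (rule sq_summable_zero)
lift_definition plus_fock :: "fock \<Rightarrow> fock \<Rightarrow> fock" is "\<lambda>f g n. f n + g n"
  by (rule sq_summable_add)
lift_definition uminus_fock :: "fock \<Rightarrow> fock" is "\<lambda>f n. - f n"
  by (simp add: sq_summable_def)
lift_definition minus_fock :: "fock \<Rightarrow> fock \<Rightarrow> fock" is "\<lambda>f g n. f n - g n"
  using sq_summable_add sq_summable_scale[where c = "-1"] by fastforce
lift_definition scaleR_fock :: "real \<Rightarrow> fock \<Rightarrow> fock" is "\<lambda>r f n. complex_of_real r * f n"
  by (rule sq_summable_scale)

instance
  by standard (transfer; simp add: fun_eq_iff algebra_simps)+

end

lift_definition cscale :: "complex \<Rightarrow> fock \<Rightarrow> fock" (infixr "*\<^sub>C" 75) is "\<lambda>c f n. c * f n"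
  by (rule sq_summable_scale)

definition cinner :: "fock \<Rightarrow> fock \<Rightarrow> complex"
  where "cinner \<phi> \<psi> = (\<Sum>n. cnj (coord \<phi> n) * coord \<psi> n)"

lemma summable_cinner: "summable (\<lambda>n. cnj (coord \<phi> n) * coord \<psi> n)"
  using coord sq_summable_mult by blast

lemma summable_coord_sq: "summable (\<lambda>n. (cmod (coord \<phi> n))\<^sup>2)"
  using coord[of \<phi>] by (simp add: sq_summable_def)

lemma cinner_self: "cinner \<phi> \<phi> = complex_of_real (\<Sum>n. (cmod (coord \<phi> n))\<^sup>2)"
proof -
  have "cnj w * w = complex_of_real ((cmod w)\<^sup>2)" for w
    by (metis complex_norm_square mult.commute)
  thus ?thesis
    unfolding cinner_def using suminf_of_real[OF summable_coord_sq, of \<phi>, where 'a = complex] by simp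
qed

instantiation fock :: real_inner
begin

definition inner_fock :: "fock \<Rightarrow> fock \<Rightarrow> real"
  where "inner_fock \<phi> \<psi> = Re (cinner \<phi> \<psi>)"

definition norm_fock :: "fock \<Rightarrow> real"
  where "norm_fock \<phi> = sqrt (inner \<phi> \<phi>)"

definition dist_fock :: "fock \<Rightarrow> fock \<Rightarrow> real"
  where "dist_fock \<phi> \<psi> = norm (\<phi> - \<psi>)"

definition sgn_fock :: "fock \<Rightarrow> fock"
  where "sgn_fock \<phi> = inverse (norm \<phi>) *\<^sub>R \<phi>"

definition uniformity_fock :: "(fock \<times> fock) filter"
  where "uniformity_fock = (INF e\<in>{0 <..}. principal {(x, y). dist x y < e})"

definition open_fock :: "fock set \<Rightarrow> bool"
  where "open_fock U = (\<forall>x\<in>U. eventually (\<lambda>(x', y). x' = x \<longrightarrow> y \<in> U) uniformity)"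

instance
proof
  fix \<phi> \<psi> \<eta> :: fock and r :: real and U :: "fock set"
  show "dist \<phi> \<psi> = norm (\<phi> - \<psi>)" by (rule dist_fock_def)
  show "sgn \<phi> = \<phi> /\<^sub>R norm \<phi>" by (rule sgn_fock_def)
  show "uniformity = (INF e\<in>{0 <..}. principal {(x, y :: fock). dist x y < e})"
    by (rule uniformity_fock_def)
  show "open U \<longleftrightarrow> (\<forall>x\<in>U. eventually (\<lambda>(x', y). x' = x \<longrightarrow> y \<in> U) uniformity)"
    by (rule open_fock_def)
  show "norm \<phi> = sqrt (inner \<phi> \<phi>)" by (rule norm_fock_def)
  have re: "inner \<alpha> \<beta> = (\<Sum>n. Re (cnj (coord \<alpha> n) * coord \<beta> n))"
    and sre: "summable (\<lambda>n. Re (cnj (coord \<alpha> n) * coord \<beta> n))" for \<alpha> \<beta> :: fock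
    unfolding inner_fock_def cinner_def
    by (intro Re_suminf summable_Re summable_cinner)+
  show "inner \<phi> \<psi> = inner \<psi> \<phi>"
    unfolding re by (intro suminf_cong) (simp add: mult.commute)
  show "inner (\<phi> + \<psi>) \<eta> = inner \<phi> \<eta> + inner \<psi> \<eta>"
  proof -
    have "inner \<phi> \<eta> + inner \<psi> \<eta> =
        (\<Sum>n. Re (cnj (coord \<phi> n) * coord \<eta> n) + Re (cnj (coord \<psi> n) * coord \<eta> n))"
      unfolding re by (intro suminf_add sre)
    also have "\<dots> = inner (\<phi> + \<psi>) \<eta>"
      unfolding re by (intro suminf_cong) (simp add: plus_fock.rep_eq algebra_simps)
    finally show ?thesis ..
  qed
  show "inner (r *\<^sub>R \<phi>) \<psi> = r * inner \<phi> \<psi>"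
  proof -
    have "r * inner \<phi> \<psi> = (\<Sum>n. r * Re (cnj (coord \<phi> n) * coord \<psi> n))"
      unfolding re by (intro suminf_mult[symmetric] sre)
    also have "\<dots> = inner (r *\<^sub>R \<phi>) \<psi>"
      unfolding re by (intro suminf_cong) (simp add: scaleR_fock.rep_eq algebra_simps)
    finally show ?thesis ..
  qed
  have self: "inner \<phi> \<phi> = (\<Sum>n. (cmod (coord \<phi> n))\<^sup>2)"
    by (simp add: inner_fock_def cinner_self)
  show "0 \<le> inner \<phi> \<phi>"
    unfolding self by (intro suminf_nonneg summable_coord_sq) simp
  show "inner \<phi> \<phi> = 0 \<longleftrightarrow> \<phi> = 0"
  proof -
    have "inner \<phi> \<phi> = 0 \<longleftrightarrow> (\<forall>n. (cmod (coord \<phi> n))\<^sup>2 = 0)"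
      unfolding self by (intro suminf_eq_zero_iff summable_coord_sq) simp
    also have "\<dots> \<longleftrightarrow> \<phi> = 0"
      by (auto simp: coord_inject[symmetric] zero_fock.rep_eq fun_eq_iff)
    finally show ?thesis .
  qed
qed

end

lemma norm_fock_eq: "norm \<phi> = sqrt (\<Sum>n. (cmod (coord \<phi> n))\<^sup>2)"
  by (simp add: norm_fock_def inner_fock_def cinner_self)

lift_definition number_state :: "nat \<Rightarrow> fock" is "\<lambda>n k. if k = n then 1 else 0"
  by (rule sq_summable_finite_support)

lemma cinner_number_state [simp]: "cinner (number_state n) \<psi> = coord \<psi> n"
proof -
  have "(\<lambda>k. cnj (coord (number_state n) k) * coord \<psi> k) = (\<lambda>k. if k = n then coord \<psi> k else 0)"
    by (auto simp: number_state.rep_eq)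
  moreover have "(\<Sum>k. if k = n then coord \<psi> k else 0) = coord \<psi> n"
    by (rule sums_unique[symmetric, OF sums_single])
  ultimately show ?thesis unfolding cinner_def by (simp only:)
qed

lemma number_state_orthonormal:
  "cinner (number_state m) (number_state n) = (if m = n then 1 else 0)"
  by (simp add: number_state.rep_eq)

lemma coord_sum_number_state:
  "coord (\<Sum>n<m. f n *\<^sub>C number_state n) k = (if k < m then f k else 0)"
  by (induction m)
     (auto simp: zero_fock.rep_eq plus_fock.rep_eq cscale.rep_eq number_state.rep_eq less_Suc_eq)

text \<open>The number states are complete: square-summable coordinate sequences give series that
  converge in norm to the vector with these coordinates.\<close>

lemma number_state_expansion:
  assumes "f \<in> sq_summable"
  shows "(\<lambda>n. f n *\<^sub>C number_state n) sums Fock f"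
proof -
  have sf: "summable (\<lambda>n. (cmod (f n))\<^sup>2)" using assms by (simp add: sq_summable_def)
  have n: "norm (Fock f - (\<Sum>n<m. f n *\<^sub>C number_state n)) = sqrt (\<Sum>n. (cmod (f (n + m)))\<^sup>2)" for m
  proof -
    let ?g = "\<lambda>k. (cmod (coord (Fock f - (\<Sum>n<m. f n *\<^sub>C number_state n)) k))\<^sup>2"
    have g: "?g k = (if k < m then 0 else (cmod (f k))\<^sup>2)" for k
      by (simp add: minus_fock.rep_eq coord_sum_number_state Fock_inverse[OF assms])
    have "suminf ?g = (\<Sum>k. ?g (k + m)) + (\<Sum>k<m. ?g k)"
      by (rule suminf_split_initial_segment[OF summable_coord_sq])
    also have "\<dots> = (\<Sum>n. (cmod (f (n + m)))\<^sup>2)" unfolding g by simp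
    finally show ?thesis by (simp add: norm_fock_eq)
  qed
  have "(\<lambda>m. \<Sum>n. (cmod (f (n + m)))\<^sup>2) \<longlonglongrightarrow> 0"
    by (rule suminf_exist_split2[OF sf])
  hence "(\<lambda>m. sqrt (\<Sum>n. (cmod (f (n + m)))\<^sup>2)) \<longlonglongrightarrow> 0"
    using tendsto_real_sqrt by fastforce
  hence "(\<lambda>m. norm (Fock f - (\<Sum>n<m. f n *\<^sub>C number_state n))) \<longlonglongrightarrow> 0"
    by (simp only: n)
  hence "(\<lambda>m. norm ((\<Sum>n<m. f n *\<^sub>C number_state n) - Fock f)) \<longlonglongrightarrow> 0"
    by (simp only: norm_minus_commute)
  hence "(\<lambda>m. \<Sum>n<m. f n *\<^sub>C number_state n) \<longlonglongrightarrow> Fock f"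
    by (simp only: LIM_zero_iff tendsto_norm_zero_iff)
  thus ?thesis by (simp add: sums_def)
qed


section \<open>The annihilation operator\<close>

definition qnum :: "real \<Rightarrow> nat \<Rightarrow> real"
  where "qnum q n = (1 - q ^ n) / (1 - q)"

definition qfact :: "real \<Rightarrow> nat \<Rightarrow> real"
  where "qfact q n = (\<Prod>k=1..n. qnum q k)"

definition ann_coeff :: "real \<Rightarrow> real \<Rightarrow> real \<Rightarrow> nat \<Rightarrow> real"
  where "ann_coeff q l lam n = sqrt (l\<^sup>2 * q powr (lam - real n) * qnum q n)"

text \<open>
  The operator is unbounded if \<open>q < 1\<close>. It is taken with its maximal domain, i.e. as the closure of
  its restriction to finite linear combinations of number states. Its action on number states is
  verified below.
\<close>

definition ann_domain :: "real \<Rightarrow> real \<Rightarrow> real \<Rightarrow> fock set"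
  where "ann_domain q l lam =
    {\<psi>. (\<lambda>n. complex_of_real (ann_coeff q l lam (Suc n)) * coord \<psi> (Suc n)) \<in> sq_summable}"

definition ann :: "real \<Rightarrow> real \<Rightarrow> real \<Rightarrow> fock \<Rightarrow> fock"
  where "ann q l lam \<psi> =
    Fock (\<lambda>n. complex_of_real (ann_coeff q l lam (Suc n)) * coord \<psi> (Suc n))"

lemma ann_number_state_0:
  "number_state 0 \<in> ann_domain q l lam" "ann q l lam (number_state 0) = 0"
  by (simp_all add: ann_domain_def ann_def number_state.rep_eq sq_summable_zero zero_fock_def)

lemma ann_number_state_Suc:
  "number_state (Suc n) \<in> ann_domain q l lam"
  "ann q l lam (number_state (Suc n)) =
     complex_of_real (ann_coeff q l lam (Suc n)) *\<^sub>C number_state n"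
proof -
  let ?f = "\<lambda>k. complex_of_real (ann_coeff q l lam (Suc k)) * coord (number_state (Suc n)) (Suc k)"
  have f: "?f = coord (complex_of_real (ann_coeff q l lam (Suc n)) *\<^sub>C number_state n)"
    by (auto simp: number_state.rep_eq cscale.rep_eq fun_eq_iff)
  show "number_state (Suc n) \<in> ann_domain q l lam"
    unfolding ann_domain_def mem_Collect_eq f by (rule coord)
  show "ann q l lam (number_state (Suc n)) =
     complex_of_real (ann_coeff q l lam (Suc n)) *\<^sub>C number_state n"
    unfolding ann_def f by (rule coord_inverse)
qed


section \<open>Coherent states\<close>

definition coh_radius :: "real \<Rightarrow> real \<Rightarrow> real \<Rightarrow> ereal"
  where "coh_radius q l lam = (if q < 1 then \<infinity> else ereal (l\<^sup>2 * q powr lam / (q - 1)))"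

definition coh_domain :: "real \<Rightarrow> real \<Rightarrow> real \<Rightarrow> complex set"
  where "coh_domain q l lam = {z. ereal ((cmod z)\<^sup>2) < coh_radius q l lam}"

definition coh_norm :: "real \<Rightarrow> real \<Rightarrow> real \<Rightarrow> real \<Rightarrow> real"
  where "coh_norm q l lam x =
    (\<Sum>n. q powr (real (n * (n + 1)) / 2) * x ^ n / ((l\<^sup>2 * q powr lam) ^ n * qfact q n))"

definition coh_coeff :: "real \<Rightarrow> real \<Rightarrow> real \<Rightarrow> complex \<Rightarrow> nat \<Rightarrow> complex"
  where "coh_coeff q l lam z n =
    complex_of_real (q powr (real (n * (n + 1)) / 4)) * z ^ n /
    complex_of_real (sqrt ((l\<^sup>2 * q powr lam) ^ n * qfact q n))"

definition coherent_state :: "real \<Rightarrow> real \<Rightarrow> real \<Rightarrow> complex \<Rightarrow> fock"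
  where "coherent_state q l lam z =
    (coh_norm q l lam ((cmod z)\<^sup>2) powr (-1/2)) *\<^sub>R
    (\<Sum>n. coh_coeff q l lam z n *\<^sub>C number_state n)"

text \<open>
  Up to a positive factor, the overlap of the states labelled \<open>z1\<close> and \<open>z2\<close> is the analytic
  continuation of \<open>coh_norm\<close> evaluated at \<open>cnj z1 * z2\<close>. For \<open>q > 1\<close> it has no zeros. For \<open>q < 1\<close> it
  is, by Euler's identity, an infinite product with simple zeros at the points
  \<open>- l\<^sup>2 * q powr lam / ((1 - q) * q ^ k)\<close>, \<open>k \<ge> 1\<close>, so that some pairs of distinct coherent states
  are orthogonal, for instance \<open>z1 = 2\<close> and \<open>z2 = -2\<close> if \<open>q = 1/2\<close>, \<open>l = 1\<close>, \<open>lam = 0\<close>. Any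
  non-orthogonality claim has to exclude exactly these values of \<open>cnj z1 * z2\<close>.
\<close>

text \<open>The rank-one operator that the coherent state labelled \<open>z\<close> contributes to the resolution of
  unity (ket times bra).\<close>

definition coh_ketbra :: "real \<Rightarrow> real \<Rightarrow> real \<Rightarrow> complex \<Rightarrow> fock \<Rightarrow> fock"
  where "coh_ketbra q l lam z \<psi> =
    cinner (coherent_state q l lam z) \<psi> *\<^sub>C coherent_state q l lam z"


section \<open>Resolution of unity\<close>

text \<open>Operator-valued integrals are understood weakly, i.e. through all matrix elements.\<close>

subsection \<open>Case \<open>0 < q < 1\<close>\<close>

definition coh_measure :: "real \<Rightarrow> real \<Rightarrow> real \<Rightarrow> complex measure"
  where "coh_measure q l lam = density lborel (\<lambda>z. indicator (coh_domain q l lam) z *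
    ennreal ((1 - q) / (l\<^sup>2 * q powr lam * ln (inverse q)) *
             (coh_norm q l lam ((cmod z)\<^sup>2) / coh_norm q l lam ((cmod z)\<^sup>2 / q)) / pi))"

definition resolves_unity_Lebesgue :: "real \<Rightarrow> real \<Rightarrow> real \<Rightarrow> bool"
  where "resolves_unity_Lebesgue q l lam \<longleftrightarrow>
    (\<forall>\<phi> \<psi>. has_bochner_integral (coh_measure q l lam)
       (\<lambda>z. cinner \<phi> (coh_ketbra q l lam z \<psi>)) (cinner \<phi> \<psi>))"

subsection \<open>Case \<open>q > 1\<close>\<close>

definition has_Jackson_integral ::
    "real \<Rightarrow> real \<Rightarrow> real \<Rightarrow> (real \<Rightarrow> complex) \<Rightarrow> complex \<Rightarrow> real \<Rightarrow> bool"
  where "has_Jackson_integral q l lam f I A \<longleftrightarrow>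
    (\<exists>S. (\<lambda>k. complex_of_real (q powr (- real k)) * f (A * q powr (- real k))) sums S \<and>
         I = complex_of_real ((q - 1) / (l\<^sup>2 * q powr lam) * A) * S)"

definition coh_angular_element ::
    "real \<Rightarrow> real \<Rightarrow> real \<Rightarrow> fock \<Rightarrow> fock \<Rightarrow> real \<Rightarrow> real \<Rightarrow> complex"
  where "coh_angular_element q l lam \<phi> \<psi> x \<theta> =
    cinner \<phi> (coh_ketbra q l lam (complex_of_real (sqrt x) * cis \<theta>) \<psi>)"

definition coh_radial_element ::
    "real \<Rightarrow> real \<Rightarrow> real \<Rightarrow> fock \<Rightarrow> fock \<Rightarrow> real \<Rightarrow> complex"
  where "coh_radial_element q l lam \<phi> \<psi> x =
    complex_of_real (1 / (2 * pi) * (1 / (1 - (q - 1) * x / (l\<^sup>2 * q powr lam)))) *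
    integral {0..2 * pi} (coh_angular_element q l lam \<phi> \<psi> x)"

text \<open>
  The integration range is the open interval from \<open>0\<close> to \<open>R\<close>, with \<open>R\<close> the (finite) squared radius.
  The Jackson sum with upper limit \<open>R\<close> samples the integrand at \<open>R\<close>, \<open>R / q\<close>, \<open>R / q\<^sup>2\<close>, \dots; all
  nodes but the first are inside the range. At \<open>R\<close> itself the formula for the integrand is the
  indeterminate product of a pole of the weight and the zero of the inverse normalization, so its
  value there is its limit from the left. (Leaving the node out would lose a non-zero
  contribution, and the integral would not be the identity.)
\<close>

definition resolves_unity_Jackson :: "real \<Rightarrow> real \<Rightarrow> real \<Rightarrow> bool"
  where "resolves_unity_Jackson q l lam \<longleftrightarrow>
    (let R = l\<^sup>2 * q powr lam / (q - 1) in
     \<forall>\<phi> \<psi>.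
       (\<forall>x\<in>{0<..<R}. coh_angular_element q l lam \<phi> \<psi> x integrable_on {0..2 * pi}) \<and>
       (\<exists>c. (coh_radial_element q l lam \<phi> \<psi> \<longlongrightarrow> c) (at_left R) \<and>
            has_Jackson_integral q l lam ((coh_radial_element q l lam \<phi> \<psi>)(R := c))
              (cinner \<phi> \<psi>) R))"

end

(* The squared amplitudes w_n of the coherent states satisfy
   w_(n+1) (1 - q^(n+1)) = s q^(n+1) w_n with s = (1 - q) / (l^2 q^lambda), for q < 1 and for q > 1
   alike. For the generating function this says gen (x / q) = (1 + s x) gen x. Iterating this
   equation locates the zeros of gen, hence the orthogonal pairs; continuity of the overlaps gives
   continuity of the states, which are unit vectors.

   For q < 1 put h x = 1 / N (x / q). The functional equation becomes s x h(x) = h(q x) - h(x), so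
   the integral of h is a Frullani integral and the higher moments follow by scaling; they equal
   ln (1/q) / (s w_n). Averaging over rotations and Parseval on circles turn the integral of
   |<z|eta>|^2 into a sum of these moments, and polarization yields the matrix elements. For q > 1
   the same functional equation makes the Jackson moments telescope. *)

theory Submission
  imports Defs
begin

section \<open>Sesquilinearity and sequences\<close>

text \<open>In both cases the measure combines with the factor \<open>1 / N x\<close> of a ket-bra
  to a constant multiple of \<open>1 / N (x / q)\<close>. What remains is a moment problem: the n-th
  moment of this function has to undo the weight \<open>w n\<close>. For q < 1 the obstacle is the
  exchange of the integral with two infinite series. On the diagonal every integrand is nonnegative,
  so Tonelli applies without prior integrability and finiteness comes out of the moments; the
  general matrix elements then inherit integrability. Polar coordinates are replaced by two facts:
  rotations preserve area, and the squared modulus pushes area forward to pi times length on the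
  positive half-line. For q > 1 the obstacle is the node on the boundary, where the series of
  \<open>N\<close> diverges. But R / q is an interior point, so \<open>1 / N (x / q)\<close> is
  regular up to R and supplies the left limit, while the numerator stays continuous because
  \<open>w n * R ^ n\<close> is bounded in n. The sums over nodes and over n are exchanged by
  Tannery's theorem: the normalized partial Jackson sums of all moments lie between 0 and 1.\<close>

lemma cinner_commute: "cinner \<psi> \<phi> = cnj (cinner \<phi> \<psi>)"
proof -
  have "(\<lambda>n. cnj (cnj (coord \<phi> n) * coord \<psi> n)) sums cnj (cinner \<phi> \<psi>)"
    unfolding sums_cnj cinner_def by (rule summable_sums[OF summable_cinner])
  thus ?thesis
    by (simp add: cinner_def sums_iff mult.commute)
qed

lemma cinner_add_right: "cinner \<phi> (\<psi> + \<eta>) = cinner \<phi> \<psi> + cinner \<phi> \<eta>"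
  unfolding cinner_def
  by (subst suminf_add[OF summable_cinner summable_cinner])
     (simp add: plus_fock.rep_eq algebra_simps)

lemma cinner_cscale_right: "cinner \<phi> (a *\<^sub>C \<psi>) = a * cinner \<phi> \<psi>"
  unfolding cinner_def
  by (subst suminf_mult[OF summable_cinner, symmetric]) (simp add: cscale.rep_eq algebra_simps)

lemma cinner_add_left: "cinner (\<phi> + \<eta>) \<psi> = cinner \<phi> \<psi> + cinner \<eta> \<psi>"
  by (metis cinner_add_right cinner_commute complex_cnj_add)

lemma cinner_cscale_left: "cinner (a *\<^sub>C \<phi>) \<psi> = cnj a * cinner \<phi> \<psi>"
  by (metis cinner_cscale_right cinner_commute complex_cnj_mult)

lemma cinner_self_norm: "cinner \<phi> \<phi> = complex_of_real ((norm \<phi>)\<^sup>2)"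
  by (simp add: norm_fock_eq cinner_self suminf_nonneg summable_coord_sq)

text \<open>Makes norm continuity of the states a question about one scalar function, the
  overlap.\<close>

lemma dist_unit_vectors:
  assumes "cinner \<phi> \<phi> = 1" "cinner \<psi> \<psi> = 1"
  shows "dist \<phi> \<psi> = sqrt (2 - 2 * Re (cinner \<phi> \<psi>))"
proof -
  have "(dist \<phi> \<psi>)\<^sup>2 = inner \<phi> \<phi> + inner \<psi> \<psi> - 2 * inner \<phi> \<psi>"
    by (simp add: dist_norm power2_norm_eq_inner inner_diff inner_commute)
  also have "\<dots> = 2 - 2 * Re (cinner \<phi> \<psi>)"
    using assms by (simp add: inner_fock_def)
  finally show ?thesis
    by (metis real_sqrt_unique zero_le_dist)
qed

lemma qnum_pos:
  assumes "0 < q" "q \<noteq> 1"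
  shows "0 < qnum q (Suc n)"
proof (cases "q < 1")
  case True
  then show ?thesis using assms power_Suc_less_one[of q n] by (simp add: qnum_def)
next
  case False
  then have "1 < q ^ Suc n" using assms by (intro one_less_power) auto
  then show ?thesis using False assms by (auto simp: qnum_def divide_neg_neg)
qed

text \<open>\<open>sq_summable_mult\<close> applied to the sequences of moduli yields absolute
  convergence, which Parseval on circles asks for.\<close>

lemma summable_prod_norm:
  fixes a b :: "nat \<Rightarrow> complex"
  assumes "a \<in> sq_summable" "b \<in> sq_summable"
  shows "summable (\<lambda>n. norm (a n * b n))"
proof -
  have "(\<lambda>n. of_real (cmod (a n))) \<in> sq_summable" "(\<lambda>n. of_real (cmod (b n))) \<in> sq_summable"
    using assms by (simp_all add: sq_summable_def)
  from sq_summable_mult[OF this]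
  have "summable (\<lambda>n. complex_of_real (cmod (a n * b n)))"
    by (simp add: norm_mult)
  from summable_Re[OF this] show ?thesis by simp
qed

section \<open>Rotation invariance and circle averages\<close>

text \<open>A Borel measure with the right value on boxes is \<open>lborel\<close>. The preimage of
  a box is its image under the inverse map, again orthogonal, and such images keep their Lebesgue
  measure.\<close>

lemma lborel_distr_orthogonal:
  fixes f :: "real^'n::{finite,wellorder} \<Rightarrow> real^'n::_"
  assumes f: "orthogonal_transformation f"
  shows "distr lborel borel f = lborel"
proof (rule lborel_eqI[symmetric])
  fix a b :: "real^'n::{finite,wellorder}"
  assume ab: "\<And>k. k \<in> Basis \<Longrightarrow> a \<bullet> k \<le> b \<bullet> k"
  have meas: "f \<in> borel_measurable borel"
    using f by (intro borel_measurable_continuous_onI linear_continuous_on)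
      (simp add: orthogonal_transformation_linear linear_linear)
  have inv: "f -` box a b = inv f ` box a b"
    using orthogonal_transformation_bij[OF f] by (rule bij_vimage_eq_inv_image)
  have lm: "inv f ` box a b \<in> lmeasurable"
    using orthogonal_transformation_inv[OF f] by (rule measurable_orthogonal_image) simp
  have set: "f -` box a b \<in> sets borel"
    using measurable_sets[OF meas, of "box a b"] by simp
  have "emeasure (distr lborel borel f) (box a b) = emeasure lborel (f -` box a b)"
    using meas by (subst emeasure_distr) auto
  also have "\<dots> = emeasure lebesgue (inv f ` box a b)"
    using set by (simp add: inv)
  also have "\<dots> = ennreal (measure lebesgue (inv f ` box a b))"
    using lm by (simp add: emeasure_eq_measure2)
  also have "\<dots> = ennreal (measure lebesgue (box a b))"
    using orthogonal_transformation_inv[OF f] by (subst measure_orthogonal_image) auto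
  also have "\<dots> = (\<Prod>k\<in>Basis. (b - a) \<bullet> k)"
    using ab by (simp add: inner_diff_left)
  finally show "emeasure (distr lborel borel f) (box a b) = (\<Prod>k\<in>Basis. (b - a) \<bullet> k)" .
qed simp

text \<open>Identifies the complex plane with \<open>real^2\<close>, where orthogonal
  transformations act: both measures assign a rectangle the product of its sides.\<close>

lemma lborel_complex_eq_distr:
  "distr lborel borel (\<lambda>v :: real^2. Complex (v $ 1) (v $ 2)) = lborel"
proof (rule lborel_eqI[symmetric])
  fix a b :: complex
  assume ab: "\<And>k. k \<in> Basis \<Longrightarrow> a \<bullet> k \<le> b \<bullet> k"
  let ?V = "\<lambda>z. vector [Re z, Im z] :: real^2"
  have [measurable]: "(\<lambda>v :: real^2. Complex (v $ 1) (v $ 2)) \<in> borel_measurable borel"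
    by (intro borel_measurable_continuous_onI) (auto intro!: continuous_intros simp: Complex_eq)
  have "(\<lambda>v :: real^2. Complex (v $ 1) (v $ 2)) -` box a b = box (?V a) (?V b)"
    by (auto simp: mem_box_cart in_box_complex_iff forall_2)
  hence "emeasure (distr lborel borel (\<lambda>v :: real^2. Complex (v $ 1) (v $ 2))) (box a b) =
      emeasure lborel (box (?V a) (?V b))"
    by (subst emeasure_distr) auto
  also have "\<dots> = (\<Prod>k\<in>Basis. (?V b - ?V a) \<bullet> k)"
  proof (rule emeasure_lborel_box)
    have "?V a $ j \<le> ?V b $ j" for j
      using ab[of 1] ab[of \<i>] exhaust_2[of j] by (auto simp: Basis_complex_def)
    thus "?V a \<bullet> k \<le> ?V b \<bullet> k" if "k \<in> Basis" for k
      using that by (auto simp: Basis_vec_def inner_axis)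
  qed
  also have "\<dots> = (\<Prod>k\<in>Basis. (b - a) \<bullet> k)"
  proof -
    have "(Basis :: (real^2) set) = {axis 1 1, axis 2 1}"
      by (auto simp: Basis_vec_def UNIV_2)
    show ?thesis
      unfolding \<open>(Basis :: (real^2) set) = _\<close>
      by (simp add: Basis_complex_def axis_eq_axis inner_axis complex_eq_iff)
  qed
  finally show "emeasure (distr lborel borel (\<lambda>v :: real^2. Complex (v $ 1) (v $ 2))) (box a b) =
      (\<Prod>k\<in>Basis. (b - a) \<bullet> k)" .
qed simp

text \<open>In coordinates, multiplication by \<open>u\<close> is the linear isometry
  \<open>T\<close> of \<open>real^2\<close>; \<open>CT\<close> intertwines the two maps, so
  invariance is carried over along the coordinate map.\<close>

lemma lborel_complex_rotation:
  assumes "cmod u = 1"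
  shows "distr lborel borel (\<lambda>z. u * z) = lborel"
proof -
  let ?C = "\<lambda>v :: real^2. Complex (v $ 1) (v $ 2)"
  define T where "T v = (vector [Re (u * ?C v), Im (u * ?C v)] :: real^2)" for v
  have [measurable]: "?C \<in> borel_measurable borel"
    by (intro borel_measurable_continuous_onI) (auto intro!: continuous_intros simp: Complex_eq)
  have norm_C: "norm v = cmod (?C v)" for v
    by (simp add: norm_vec_def L2_set_def UNIV_2 cmod_def)
  have CT: "?C (T v) = u * ?C v" for v
    by (simp add: T_def complex_eq_iff)
  have "linear T"
    by (rule linearI) (simp_all add: T_def vec_eq_iff forall_2 algebra_simps)
  moreover have "norm (T v) = norm v" for v
    unfolding norm_C CT using assms by (simp add: norm_mult)
  ultimately have T: "orthogonal_transformation T"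
    by (simp add: orthogonal_transformation)
  have [measurable]: "T \<in> borel_measurable borel"
    using T by (intro borel_measurable_continuous_onI linear_continuous_on)
      (simp add: orthogonal_transformation_linear linear_linear)
  have "distr lborel borel (\<lambda>z. u * z) = distr (distr lborel borel ?C) borel (\<lambda>z. u * z)"
    by (simp only: lborel_complex_eq_distr)
  also have "\<dots> = distr (distr lborel borel T) borel ?C"
    by (subst (1 2) distr_distr) (auto simp: comp_def CT)
  also have "\<dots> = lborel"
    by (simp only: lborel_distr_orthogonal[OF T] lborel_complex_eq_distr)
  finally show ?thesis .
qed

text \<open>The radial half of polar coordinates. Half-lines generate the Borel sets, and the
  preimage of \<open>{..x}\<close> is a disc of area pi x.\<close>

lemma lborel_complex_distr_norm_sq:
  "distr lborel borel (\<lambda>z :: complex. (cmod z)\<^sup>2) =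
    density lborel (\<lambda>x. ennreal pi * indicator {0<..} x)" (is "?M = ?N")
proof (rule measure_eqI_generator_eq[where E = "range atMost" and \<Omega> = UNIV and A = "\<lambda>n. {..real n}"])
  have M: "emeasure ?M {..x} = ennreal (pi * max 0 x)" for x
  proof -
    have "emeasure ?M {..x} = emeasure lborel ((\<lambda>z :: complex. (cmod z)\<^sup>2) -` {..x})"
      by (subst emeasure_distr) auto
    also have "(\<lambda>z :: complex. (cmod z)\<^sup>2) -` {..x} = (if x < 0 then {} else cball 0 (sqrt x))"
      using real_le_rsqrt real_sqrt_le_iff
      by (auto simp: not_less dest: order.trans[OF zero_le_power2]) (use real_sqrt_le_iff sqrt_le_D in fastforce)+
    also have "emeasure lborel \<dots> = ennreal (pi * max 0 x)"
      by (auto simp: emeasure_cball unit_ball_vol_2 max_def)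
    finally show ?thesis .
  qed
  have N: "emeasure ?N {..x} = ennreal (pi * max 0 x)" for x
  proof -
    have "emeasure ?N {..x} = (\<integral>\<^sup>+y. ennreal pi * indicator {0<..x} y \<partial>lborel)"
      by (subst emeasure_density) (auto intro!: nn_integral_cong split: split_indicator)
    also have "\<dots> = ennreal pi * emeasure lborel {0<..x}"
      by (subst nn_integral_cmult_indicator) auto
    also have "\<dots> = ennreal (pi * max 0 x)"
      by (cases "0 \<le> x") (auto simp: ennreal_mult max_def)
    finally show ?thesis .
  qed
  show "emeasure ?M X = emeasure ?N X" if "X \<in> range atMost" for X
    using that M N by auto
  show "emeasure ?M {..real n} \<noteq> \<infinity>" for n
    by (simp add: M)
  show "Int_stable (range (atMost :: real \<Rightarrow> real set))"
    by (auto simp: Int_stable_def)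
  show "sets ?M = sigma_sets UNIV (range atMost)" "sets ?N = sigma_sets UNIV (range atMost)"
    by (simp_all add: borel_eq_atMost)
  show "(\<Union>n. {..real n}) = UNIV"
    using real_arch_simple by auto
qed auto

lemma nn_integral_complex_radial:
  assumes [measurable]: "f \<in> borel_measurable borel"
  shows "(\<integral>\<^sup>+z. f ((cmod z)\<^sup>2) \<partial>lborel) =
    ennreal pi * (\<integral>\<^sup>+x. indicator {0<..} x * f x \<partial>lborel)"
proof -
  have "(\<integral>\<^sup>+z. f ((cmod z)\<^sup>2) \<partial>lborel) =
      (\<integral>\<^sup>+x. f x \<partial>distr lborel borel (\<lambda>z :: complex. (cmod z)\<^sup>2))"
    by (subst nn_integral_distr) auto
  also have "\<dots> = (\<integral>\<^sup>+x. ennreal pi * (indicator {0<..} x * f x) \<partial>lborel)"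
    unfolding lborel_complex_distr_norm_sq
    by (subst nn_integral_density) (auto simp: mult.assoc)
  finally show ?thesis by (simp add: nn_integral_cmult)
qed

text \<open>Orthogonality of the characters of the circle: for distinct exponents the antiderivative
  is periodic, because \<open>k\<close> is a nonzero integer.\<close>

lemma has_integral_cis_power:
  "((\<lambda>\<theta>. cis \<theta> ^ i * cnj (cis \<theta>) ^ j) has_integral (if i = j then 2 * pi else 0)) {0..2 * pi}"
proof (cases "i = j")
  case True
  have "cis \<theta> ^ i * cnj (cis \<theta>) ^ i = 1" for \<theta>
    by (simp add: cis_cnj flip: power_mult_distrib) (simp add: cis_mult)
  thus ?thesis
    using True has_integral_const_real[of "1 :: complex" 0 "2 * pi"] by (simp add: scaleR_conv_of_real)
next
  case False
  define k where "k = real i - real j"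
  have k: "k \<noteq> 0" using False by (simp add: k_def)
  have eq: "cis \<theta> ^ i * cnj (cis \<theta>) ^ j = cis (k * \<theta>)" for \<theta>
  proof -
    have "real i * \<theta> + real j * - \<theta> = k * \<theta>" by (simp add: k_def algebra_simps)
    thus ?thesis by (simp only: cis_cnj Complex.DeMoivre cis_mult)
  qed
  have "((\<lambda>\<theta>. cis (k * \<theta>)) has_integral
      cis (k * (2 * pi)) / (\<i> * k) - cis (k * 0) / (\<i> * k)) {0..2 * pi}"
  proof (rule fundamental_theorem_of_calculus)
    show "((\<lambda>\<theta>. cis (k * \<theta>) / (\<i> * k)) has_vector_derivative cis (k * \<theta>))
        (at \<theta> within {0..2 * pi})" for \<theta>
      unfolding has_vector_derivative_def
      by (rule derivative_eq_intros refl | use k in \<open>simp add: scaleR_conv_of_real fun_eq_iff field_simps\<close>)+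
  qed simp
  moreover have "cis (k * (2 * pi)) = 1"
    using cis_multiple_2pi[of "k"] by (simp add: k_def mult_ac)
  ultimately show ?thesis
    using False by (simp add: eq)
qed

text \<open>For finite sums this is orthogonality of characters; absolute convergence supplies a
  constant majorant for the limit. The coefficients enter bilinearly, so the conjugated family may
  stand on either side, as its two uses require.\<close>

lemma circle_Parseval:
  fixes a b :: "nat \<Rightarrow> complex"
  assumes a: "summable (\<lambda>n. norm (a n))" and b: "summable (\<lambda>n. norm (b n))"
  shows "((\<lambda>\<theta>. (\<Sum>n. a n * cis \<theta> ^ n) * (\<Sum>n. b n * cnj (cis \<theta>) ^ n)) has_integral
    2 * pi * (\<Sum>n. a n * b n)) {0..2 * pi}"
proof (rule has_integral_dominated_convergence)
  let ?A = "\<Sum>n. norm (a n)" and ?B = "\<Sum>n. norm (b n)"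
  let ?f = "\<lambda>M \<theta>. (\<Sum>n<M. a n * cis \<theta> ^ n) * (\<Sum>n<M. b n * cnj (cis \<theta>) ^ n)"
  let ?g = "\<lambda>M. 2 * pi * (\<Sum>n<M. a n * b n)"
  show "(?f M has_integral ?g M) {0..2 * pi}" for M
  proof -
    have "((\<lambda>\<theta>. \<Sum>i<M. \<Sum>j<M. a i * b j * (cis \<theta> ^ i * cnj (cis \<theta>) ^ j)) has_integral
        (\<Sum>i<M. \<Sum>j<M. a i * b j * of_real (if i = j then 2 * pi else 0))) {0..2 * pi}"
      using has_integral_cis_power by (intro has_integral_sum has_integral_mult_right) (auto simp: if_distrib)
    also have "(\<lambda>\<theta>. \<Sum>i<M. \<Sum>j<M. a i * b j * (cis \<theta> ^ i * cnj (cis \<theta>) ^ j)) = ?f M"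
      by (simp add: sum_product mult_ac)
    also have "(\<Sum>i<M. \<Sum>j<M. a i * b j * of_real (if i = j then 2 * pi else 0)) = ?g M"
      by (simp add: if_distrib sum_distrib_left mult_ac cong: if_cong)
    finally show ?thesis .
  qed
  show "(\<lambda>\<theta>. ?A * ?B) integrable_on {0..2 * pi}"
    by (rule integrable_const_ivl)
  show "\<forall>\<theta>\<in>{0..2 * pi}. norm (?f M \<theta>) \<le> ?A * ?B" for M
  proof
    fix \<theta>
    have "norm (\<Sum>n<M. a n * cis \<theta> ^ n) \<le> (\<Sum>n<M. norm (a n))"
      by (rule sum_norm_le) (simp add: norm_mult norm_power)
    also have "\<dots> \<le> ?A" by (rule sum_le_suminf[OF a]) auto
    finally have A: "norm (\<Sum>n<M. a n * cis \<theta> ^ n) \<le> ?A" .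
    have "norm (\<Sum>n<M. b n * cnj (cis \<theta>) ^ n) \<le> (\<Sum>n<M. norm (b n))"
      by (rule sum_norm_le) (simp add: norm_mult norm_power)
    also have "\<dots> \<le> ?B" by (rule sum_le_suminf[OF b]) auto
    finally show "norm (?f M \<theta>) \<le> ?A * ?B"
      unfolding norm_mult using A by (intro mult_mono suminf_nonneg a) auto
  qed
  have sa: "summable (\<lambda>n. a n * cis \<theta> ^ n)" for \<theta>
    by (rule summable_norm_cancel) (simp add: norm_mult norm_power a)
  have sb: "summable (\<lambda>n. b n * cnj (cis \<theta>) ^ n)" for \<theta>
    by (rule summable_norm_cancel) (simp add: norm_mult norm_power b)
  show "\<forall>\<theta>\<in>{0..2 * pi}. (\<lambda>M. ?f M \<theta>) \<longlonglongrightarrow> (\<Sum>n. a n * cis \<theta> ^ n) * (\<Sum>n. b n * cnj (cis \<theta>) ^ n)"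
    by (intro ballI tendsto_mult summable_LIMSEQ sa sb)
  have "summable (\<lambda>n. a n * b n)"
  proof (rule summable_comparison_test_ev)
    have "eventually (\<lambda>n. norm (a n) < 1) sequentially"
      using order_tendstoD(2)[OF summable_LIMSEQ_zero[OF a], of 1] by simp
    thus "eventually (\<lambda>n. norm (a n * b n) \<le> norm (b n)) sequentially"
      by eventually_elim (simp add: norm_mult mult_left_le_one_le)
  qed (rule b)
  thus "?g \<longlonglongrightarrow> 2 * pi * (\<Sum>n. a n * b n)"
    by (intro tendsto_intros summable_LIMSEQ)
qed

text \<open>The angular half of polar coordinates: rotating by a fixed angle leaves the integral
  unchanged, and Tonelli permits averaging over the angle inside.\<close>

lemma nn_integral_circle_average:
  assumes [measurable]: "f \<in> borel_measurable borel"
  shows "ennreal (2 * pi) * (\<integral>\<^sup>+z. f z \<partial>lborel) =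
    (\<integral>\<^sup>+z. (\<integral>\<^sup>+\<theta>. indicator {0..2 * pi} \<theta> * f (z * cis \<theta>) \<partial>lborel) \<partial>(lborel :: complex measure))"
proof -
  have [measurable]: "cis \<in> borel_measurable borel"
    by (intro borel_measurable_continuous_onI continuous_intros)
  have rot: "(\<integral>\<^sup>+z. f (z * cis \<theta>) \<partial>lborel) = (\<integral>\<^sup>+z. f z \<partial>lborel)" for \<theta>
  proof -
    have "(\<integral>\<^sup>+z. f z \<partial>lborel) = (\<integral>\<^sup>+z. f z \<partial>distr lborel borel (\<lambda>z. cis \<theta> * z))"
      by (simp add: lborel_complex_rotation)
    also have "\<dots> = (\<integral>\<^sup>+z. f (cis \<theta> * z) \<partial>lborel)"
      by (subst nn_integral_distr) auto
    finally show ?thesis by (simp add: mult.commute)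
  qed
  have "(\<integral>\<^sup>+z. (\<integral>\<^sup>+\<theta>. indicator {0..2 * pi} \<theta> * f (z * cis \<theta>) \<partial>lborel) \<partial>lborel) =
      (\<integral>\<^sup>+\<theta>. (\<integral>\<^sup>+z. indicator {0..2 * pi} \<theta> * f (z * cis \<theta>) \<partial>lborel) \<partial>lborel)"
    by (rule lborel_pair.Fubini') measurable
  also have "\<dots> = (\<integral>\<^sup>+\<theta>. (\<integral>\<^sup>+z. f z \<partial>lborel) * indicator {0..2 * pi} \<theta> \<partial>lborel)"
    by (subst nn_integral_cmult) (auto simp: rot mult.commute)
  also have "\<dots> = (\<integral>\<^sup>+z. f z \<partial>lborel) * ennreal (2 * pi)"
    by (subst nn_integral_cmult_indicator) auto
  finally show ?thesis by (simp add: mult.commute)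
qed

text \<open>On a circle \<open>K\<close> is constant and Parseval removes the cross terms, so only
  functions of the modulus are left to integrate. Everything is nonnegative, hence the identity also
  holds with infinite values.\<close>

lemma nn_integral_powser_norm_sq:
  fixes a :: "nat \<Rightarrow> complex" and K :: "real \<Rightarrow> ennreal"
  assumes a: "\<And>r. summable (\<lambda>n. norm (a n * of_real r ^ n))"
    and [measurable]: "K \<in> borel_measurable borel"
  shows "(\<integral>\<^sup>+z. ennreal ((cmod (\<Sum>n. a n * z ^ n))\<^sup>2) * K ((cmod z)\<^sup>2) \<partial>lborel) =
    (\<Sum>n. ennreal ((cmod (a n))\<^sup>2) *
      (ennreal pi * (\<integral>\<^sup>+x. indicator {0<..} x * (ennreal (x ^ n) * K x) \<partial>lborel)))"
    (is "?L = ?R")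
proof -
  define A where "A z = (\<Sum>n. a n * z ^ n)" for z
  have "isCont A z" for z
    unfolding A_def
    by (rule isCont_powser[where K = "of_real (cmod z + 1)"])
       (use a[of "cmod z + 1", THEN summable_norm_cancel] in auto)
  hence [measurable]: "A \<in> borel_measurable borel"
    by (intro borel_measurable_continuous_onI continuous_at_imp_continuous_on) auto
  have circle: "(\<integral>\<^sup>+\<theta>. indicator {0..2 * pi} \<theta> *
        (ennreal ((cmod (A (z * cis \<theta>)))\<^sup>2) * K ((cmod (z * cis \<theta>))\<^sup>2)) \<partial>lborel) =
      ennreal (2 * pi) * (\<Sum>n. ennreal ((cmod (a n))\<^sup>2) * (ennreal (((cmod z)\<^sup>2) ^ n) * K ((cmod z)\<^sup>2)))"
    for z
  proof -
    let ?t = "\<lambda>n. (cmod (a n))\<^sup>2 * ((cmod z)\<^sup>2) ^ n"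
    have sm: "summable (\<lambda>n. norm (a n * z ^ n))"
      using a[of "cmod z"] by (simp add: norm_mult norm_power)
    hence sm': "summable (\<lambda>n. norm (cnj (a n * z ^ n)))"
      by (simp only: complex_mod_cnj)
    have t: "a n * z ^ n * cnj (a n * z ^ n) = of_real (?t n)" for n
      unfolding complex_norm_square[symmetric]
      by (simp add: norm_mult norm_power power_mult_distrib flip: power_mult) (simp add: mult.commute)
    have "summable (\<lambda>n. (norm (a n * z ^ n))\<^sup>2)"
    proof (rule summable_comparison_test_ev[OF _ sm])
      have "eventually (\<lambda>n. norm (a n * z ^ n) < 1) sequentially"
        using order_tendstoD(2)[OF summable_LIMSEQ_zero[OF sm], of 1] by simp
      thus "eventually (\<lambda>n. norm ((norm (a n * z ^ n))\<^sup>2) \<le> norm (a n * z ^ n)) sequentially"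
        by eventually_elim (simp add: power2_eq_square mult_left_le_one_le)
    qed
    hence st: "summable ?t"
      by (simp add: norm_mult norm_power power_mult_distrib flip: power_mult) (simp add: mult.commute)
    have "(\<Sum>n. a n * z ^ n * cis \<theta> ^ n) * (\<Sum>n. cnj (a n * z ^ n) * cnj (cis \<theta>) ^ n) =
        of_real ((cmod (A (z * cis \<theta>)))\<^sup>2)" for \<theta>
    proof -
      have "summable (\<lambda>n. a n * z ^ n * cis \<theta> ^ n)"
        by (rule summable_norm_cancel) (use sm in \<open>simp add: norm_mult norm_power\<close>)
      from summable_sums[OF this]
      have "(\<Sum>n. cnj (a n * z ^ n) * cnj (cis \<theta>) ^ n) = cnj (\<Sum>n. a n * z ^ n * cis \<theta> ^ n)"
        by (subst (asm) sums_cnj[symmetric]) (simp add: sums_iff)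
      thus ?thesis
        unfolding complex_norm_square A_def by (simp add: power_mult_distrib mult.assoc)
    qed
    hence "((\<lambda>\<theta>. complex_of_real ((cmod (A (z * cis \<theta>)))\<^sup>2)) has_integral
        2 * pi * (\<Sum>n. complex_of_real (?t n))) {0..2 * pi}"
      using circle_Parseval[OF sm sm'] by (simp only: t)
    from has_integral_Re[OF this[folded suminf_of_real[OF st]]]
    have "((\<lambda>\<theta>. (cmod (A (z * cis \<theta>)))\<^sup>2) has_integral 2 * pi * suminf ?t) {0..2 * pi}"
      by simp
    from nn_integral_has_integral_lebesgue[OF _ this]
    have "(\<integral>\<^sup>+\<theta>. indicator {0..2 * pi} \<theta> * ennreal ((cmod (A (z * cis \<theta>)))\<^sup>2) \<partial>lborel) =
        ennreal (2 * pi * suminf ?t)"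
      by (simp add: ennreal_mult' ennreal_indicator)
    moreover have [measurable]: "cis \<in> borel_measurable borel"
      by (intro borel_measurable_continuous_onI continuous_intros)
    ultimately have "(\<integral>\<^sup>+\<theta>. indicator {0..2 * pi} \<theta> *
        (ennreal ((cmod (A (z * cis \<theta>)))\<^sup>2) * K ((cmod (z * cis \<theta>))\<^sup>2)) \<partial>lborel) =
        ennreal (2 * pi * suminf ?t) * K ((cmod z)\<^sup>2)"
      by (simp add: norm_mult nn_integral_multc flip: mult.assoc)
    also have "ennreal (2 * pi * suminf ?t) = ennreal (2 * pi) * (\<Sum>n. ennreal (?t n))"
      by (subst suminf_ennreal2[OF _ st]) (auto intro!: ennreal_mult suminf_nonneg st)
    also have "\<dots> * K ((cmod z)\<^sup>2) =
        ennreal (2 * pi) * (\<Sum>n. ennreal ((cmod (a n))\<^sup>2) * (ennreal (((cmod z)\<^sup>2) ^ n) * K ((cmod z)\<^sup>2)))"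
      by (simp only: mult.assoc ennreal_suminf_multc[symmetric] ennreal_mult zero_le_power2 zero_le_power)
    finally show ?thesis .
  qed
  \<comment> \<open>The factor 2 pi is the length of the averaging interval; being finite and
    nonzero, it can be cancelled at the end.\<close>
  have "ennreal (2 * pi) * ?L =
      (\<integral>\<^sup>+z. ennreal (2 * pi) * (\<Sum>n. ennreal ((cmod (a n))\<^sup>2) * (ennreal (((cmod z)\<^sup>2) ^ n) * K ((cmod z)\<^sup>2))) \<partial>lborel)"
    unfolding A_def[symmetric] by (subst nn_integral_circle_average) (auto simp: circle)
  also have "\<dots> = ennreal (2 * pi) *
      (\<Sum>n. ennreal ((cmod (a n))\<^sup>2) * (\<integral>\<^sup>+z. ennreal (((cmod z)\<^sup>2) ^ n) * K ((cmod z)\<^sup>2) \<partial>lborel))"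
    by (subst nn_integral_cmult, measurable) (simp add: nn_integral_suminf nn_integral_cmult)
  also have "\<dots> = ennreal (2 * pi) * ?R"
    by (subst nn_integral_complex_radial) auto
  finally show ?thesis
    by (simp add: ennreal_mult_cancel_left)
qed

section \<open>Weights and the functional equation\<close>

locale coherent_states =
  fixes q l lam :: real
  assumes q_pos: "0 < q" and q_neq: "q \<noteq> 1" and l_neq: "l \<noteq> 0"
begin

definition c :: real where "c = l\<^sup>2 * q powr lam"

text \<open>The sign of \<open>s\<close> separates the cases: for q < 1 the factor 1 + s x is
  positive on x \<ge> 0, for q > 1 it vanishes exactly at the squared radius.\<close>

definition s :: real where "s = (1 - q) / c"

definition w :: "nat \<Rightarrow> real"
  where "w n = q powr (real (n * (n + 1)) / 2) / (c ^ n * qfact q n)"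

text \<open>The complex extension of \<open>N\<close>; overlaps of distinct states evaluate it off
  the real axis.\<close>

definition gen :: "complex \<Rightarrow> complex" where "gen x = (\<Sum>n. of_real (w n) * x ^ n)"

abbreviation radius :: ereal where "radius \<equiv> coh_radius q l lam"

abbreviation N :: "real \<Rightarrow> real" where "N \<equiv> coh_norm q l lam"

abbreviation ket :: "complex \<Rightarrow> fock" where "ket \<equiv> coherent_state q l lam"

section \<open>Recurrence of the weights\<close>

lemma c_pos: "0 < c"
  using q_pos l_neq by (simp add: c_def)

lemma w_0 [simp]: "w 0 = 1"
  using q_pos by (simp add: w_def qfact_def)

lemma w_Suc: "w (Suc n) = w n * (q ^ Suc n / (c * qnum q (Suc n)))"
proof -
  have "real (Suc n * (Suc n + 1)) / 2 = real (n * (n + 1)) / 2 + real (Suc n)"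
    by (simp add: field_simps)
  hence "q powr (real (Suc n * (Suc n + 1)) / 2) = q powr (real (n * (n + 1)) / 2) * q ^ Suc n"
    using q_pos by (simp only: powr_add powr_realpow)
  thus ?thesis
    by (simp add: w_def qfact_def)
qed

lemma w_pos: "0 < w n"
proof (induction n)
  case (Suc n)
  then show ?case
    unfolding w_Suc using q_pos c_pos qnum_pos[OF q_pos q_neq, of n]
    by (intro mult_pos_pos divide_pos_pos) auto
qed simp

lemma w_rec: "w (Suc n) * (1 - q ^ Suc n) = w n * (s * q ^ Suc n)"
proof -
  have "1 - q ^ Suc n = qnum q (Suc n) * (1 - q)"
    using q_neq by (simp add: qnum_def)
  thus ?thesis
    using qnum_pos[OF q_pos q_neq, of n] c_pos by (simp add: w_Suc s_def)
qed

text \<open>The eigenvalue equation in coordinates: with it, the shift of the annihilation operator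
  sends the amplitudes \<open>sqrt (w n) * z ^ n\<close> to \<open>z\<close> times
  themselves.\<close>

lemma ann_coeff_w: "ann_coeff q l lam (Suc n) * sqrt (w (Suc n)) = sqrt (w n)"
proof -
  have "l\<^sup>2 * q powr (lam - real (Suc n)) * qnum q (Suc n) = c * qnum q (Suc n) / q ^ Suc n"
    using q_pos by (simp add: c_def powr_diff powr_realpow del: of_nat_Suc power_Suc)
  then show ?thesis
    unfolding ann_coeff_def real_sqrt_mult[symmetric] w_Suc
    using q_pos c_pos qnum_pos[OF q_pos q_neq, of n] by simp
qed

lemma coh_coeff_eq: "coh_coeff q l lam z n = of_real (sqrt (w n)) * z ^ n"
proof -
  have "sqrt (q powr (real (n * (n + 1)) / 2)) = q powr (real (n * (n + 1)) / 4)"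
    using q_pos by (intro real_sqrt_unique) (simp_all add: power2_eq_square flip: powr_add)
  thus ?thesis
    by (simp add: coh_coeff_def w_def c_def real_sqrt_divide)
qed

section \<open>The generating power series: radius, continuity, functional equation and
  zeros\<close>

lemma coh_norm_eq: "N x = (\<Sum>n. w n * x ^ n)"
  by (simp add: coh_norm_def w_def c_def)

text \<open>Ratio test: in \<open>ratio\<close> the power of 1 / q explodes for q < 1 and dies out
  for q > 1, where it leaves c / (q - 1). So \<open>coh_domain\<close> is exactly the disc given by
  the radius of convergence in the squared modulus.\<close>

lemma conv_radius_w: "conv_radius (\<lambda>n. of_real (w n) :: complex) = radius"
proof (rule conv_radius_ratio_limit_ereal)
  show "eventually (\<lambda>n. (of_real (w n) :: complex) \<noteq> 0) sequentially"
    using w_pos by (simp add: less_imp_neq[symmetric] order.strict_implies_not_eq)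
  have ratio: "w n / w (Suc n) = c * ((1 / q) ^ Suc n - 1) / (1 - q)" for n
  proof -
    have "w n / w (Suc n) = c * qnum q (Suc n) / q ^ Suc n"
      using w_pos[of n] by (simp add: w_Suc)
    moreover have "1 / q ^ Suc n - 1 = (1 - q ^ Suc n) / q ^ Suc n"
      using q_pos by (simp add: diff_divide_distrib)
    ultimately show ?thesis by (simp add: qnum_def power_divide del: power_Suc)
  qed
  show "(\<lambda>n. ereal (norm (complex_of_real (w n)) / norm (complex_of_real (w (Suc n)))))
      \<longlonglongrightarrow> radius"
  proof (cases "q < 1")
    case True
    have "filterlim (\<lambda>n. inverse (q ^ Suc n)) at_top sequentially"
      using q_pos True
      by (intro filterlim_inverse_at_top LIMSEQ_Suc LIMSEQ_realpow_zero always_eventually) auto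
    hence "filterlim (\<lambda>n. (c / (1 - q)) * (- 1 + (1 / q) ^ Suc n)) at_top sequentially"
      using True c_pos
      by (intro filterlim_tendsto_pos_mult_at_top[OF tendsto_const]
            filterlim_tendsto_add_at_top[OF tendsto_const])
         (auto simp: divide_inverse power_inverse)
    hence "filterlim (\<lambda>n. w n / w (Suc n)) at_top sequentially"
      by (simp add: ratio)
    thus ?thesis
      using True w_pos by (simp add: coh_radius_def tendsto_PInfty_eq_at_top abs_of_pos)
  next
    case False
    hence "(\<lambda>n. (1 / q) ^ Suc n) \<longlonglongrightarrow> 0"
      using q_neq by (subst filterlim_sequentially_Suc) (intro LIMSEQ_power_zero, simp)
    hence "(\<lambda>n. c * ((1 / q) ^ Suc n - 1) / (1 - q)) \<longlonglongrightarrow> c * (0 - 1) / (1 - q)"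
      using q_neq by (intro tendsto_intros) auto
    hence "(\<lambda>n. w n / w (Suc n)) \<longlonglongrightarrow> c / (q - 1)"
      using q_neq by (simp add: ratio minus_divide_right del: power_Suc)
    thus ?thesis
      using False q_neq w_pos by (simp add: coh_radius_def c_def abs_of_pos)
  qed
qed

lemma summable_w_complex:
  "ereal (cmod x) < radius \<Longrightarrow> summable (\<lambda>n. of_real (w n) * x ^ n)"
  by (rule summable_in_conv_radius) (simp add: conv_radius_w)

lemma summable_w:
  assumes "0 \<le> x" "ereal x < radius"
  shows "summable (\<lambda>n. w n * x ^ n)"
proof -
  have "summable (\<lambda>n. norm (of_real (w n) * (of_real x :: complex) ^ n))"
    using assms by (intro abs_summable_in_conv_radius) (simp add: conv_radius_w)
  thus ?thesis
    using assms w_pos by (simp add: norm_mult norm_power abs_of_pos)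
qed

lemma gen_of_real:
  assumes "0 \<le> x" "ereal x < radius"
  shows "gen (of_real x) = of_real (N x)"
  unfolding gen_def coh_norm_eq
  using suminf_of_real[OF summable_w[OF assms], where 'a = complex] by simp

lemma coh_norm_ge_1:
  assumes "0 \<le> x" "ereal x < radius"
  shows "1 \<le> N x"
proof -
  have "(\<Sum>n<1. w n * x ^ n) \<le> N x"
    unfolding coh_norm_eq using assms w_pos
    by (intro sum_le_suminf summable_w) (auto simp: less_imp_le)
  thus ?thesis by simp
qed

lemma gen_0 [simp]: "gen 0 = 1"
  by (simp add: gen_def)

lemma isCont_gen:
  assumes "ereal (cmod x) < radius"
  shows "isCont gen x"
proof -
  obtain r where r: "cmod x < r" "ereal r < radius"
    using assms ereal_dense2 by (metis less_ereal.simps(1))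
  hence "0 < r" using norm_ge_zero[of x] by linarith
  have "isCont (\<lambda>x. \<Sum>n. of_real (w n) * x ^ n) x"
    using r \<open>0 < r\<close> by (intro isCont_powser[where K = "of_real r"] summable_w_complex) auto
  thus ?thesis by (simp add: gen_def[abs_def])
qed

text \<open>This is \<open>w_rec\<close> summed over n: in the difference of the two series the
  constant terms cancel, and the index shift brings out the factor s x.\<close>

lemma gen_div_q:
  assumes x: "ereal (cmod x) < radius"
    and xq: "ereal (cmod (x / of_real q)) < radius"
  shows "gen (x / of_real q) = (1 + of_real s * x) * gen x"
proof -
  let ?a = "\<lambda>n. of_real (w n) * (x / of_real q) ^ n - of_real (w n) * x ^ n"
  have a0: "?a 0 = 0" by simp
  have aS: "?a (Suc n) = of_real s * x * (of_real (w n) * x ^ n)" for n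
  proof -
    have "?a (Suc n) = of_real (w (Suc n) * (1 - q ^ Suc n)) * (x / of_real q) ^ Suc n"
      using q_pos by (simp add: power_divide field_simps)
    also have "\<dots> = of_real s * x * (of_real (w n) * x ^ n)"
      unfolding w_rec using q_pos by (simp add: power_divide field_simps)
    finally show ?thesis .
  qed
  have "gen (x / of_real q) - gen x = suminf ?a"
    unfolding gen_def by (rule suminf_diff[OF summable_w_complex[OF xq] summable_w_complex[OF x]])
  also have "\<dots> = (\<Sum>n. ?a (Suc n))"
    using suminf_split_head[of ?a] summable_diff[OF summable_w_complex[OF xq] summable_w_complex[OF x]] a0
    by simp
  also have "\<dots> = of_real s * x * gen x"
    unfolding aS gen_def by (rule suminf_mult[OF summable_w_complex[OF x]])
  finally show ?thesis by (simp add: algebra_simps)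
qed

lemma coh_norm_div_q:
  assumes x: "0 \<le> x" "ereal x < radius" "ereal (x / q) < radius"
  shows "N (x / q) = (1 + s * x) * N x"
proof -
  have "complex_of_real (N (x / q)) = gen (of_real x / of_real q)"
    using x q_pos by (simp flip: gen_of_real)
  also have "\<dots> = (1 + of_real s * of_real x) * gen (of_real x)"
    using x q_pos by (intro gen_div_q) (auto simp: norm_divide)
  also have "\<dots> = of_real ((1 + s * x) * N x)"
    using x by (simp add: gen_of_real)
  finally show ?thesis by (simp only: of_real_eq_iff)
qed

text \<open>Iterating \<open>gen_div_q\<close> pushes the argument to \<open>0\<close>, where \<open>gen\<close> is \<open>1\<close>: a zero of \<open>gen\<close> must
  come from one of the factors.\<close>

lemma gen_eq_0_iff:
  assumes x: "ereal (cmod x) < radius"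
  shows "gen x = 0 \<longleftrightarrow> q < 1 \<and> (\<exists>k::nat. k \<ge> 1 \<and> x = of_real (- c / ((1 - q) * q ^ k)))"
proof (cases "q < 1")
  case True
  have rad: "ereal y < radius" for y using True by (simp add: coh_radius_def)
  have s: "s > 0" using True c_pos by (simp add: s_def)
  have step: "gen y = (1 + of_real s * (of_real q * y)) * gen (of_real q * y)" for y
    using gen_div_q[of "of_real q * y", OF rad rad] q_pos by simp
  have zero: "1 + of_real s * (of_real (q ^ k) * x) = 0 \<longleftrightarrow> x = of_real (- c / ((1 - q) * q ^ k))" for k
  proof -
    have "1 + of_real s * (of_real (q ^ k) * x) = 0 \<longleftrightarrow> of_real (s * q ^ k) * x = -1"
      by (simp add: add_eq_0_iff mult.assoc)
    also have "\<dots> \<longleftrightarrow> x = of_real (- 1 / (s * q ^ k))"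
      using s q_pos by (simp add: field_simps)
    also have "- 1 / (s * q ^ k) = - c / ((1 - q) * q ^ k)"
      using c_pos True by (simp add: s_def)
    finally show ?thesis .
  qed
  show ?thesis
  proof
    assume 0: "gen x = 0"
    have "\<exists>k\<ge>1. 1 + of_real s * (of_real (q ^ k) * x) = 0"
    proof (rule ccontr)
      assume "\<not> ?thesis"
      hence nz: "1 + of_real s * (of_real (q ^ Suc k) * x) \<noteq> 0" for k
        by (metis One_nat_def le_add1 plus_1_eq_Suc)
      have "gen (of_real (q ^ k) * x) = 0" for k
      proof (induction k)
        case (Suc k)
        then show ?case
          using step[of "of_real (q ^ k) * x"] nz[of k] by (simp add: mult.assoc)
      qed (use 0 in simp)
      moreover have "(\<lambda>k. gen (of_real (q ^ k) * x)) \<longlonglongrightarrow> gen (of_real 0 * x)"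
        using q_pos True
        by (intro isCont_tendsto_compose[OF isCont_gen] rad tendsto_intros LIMSEQ_realpow_zero) auto
      ultimately show False by (simp add: LIMSEQ_const_iff)
    qed
    thus "q < 1 \<and> (\<exists>k::nat. k \<ge> 1 \<and> x = of_real (- c / ((1 - q) * q ^ k)))"
      unfolding zero using True by blast
  next
    assume "q < 1 \<and> (\<exists>k::nat. k \<ge> 1 \<and> x = of_real (- c / ((1 - q) * q ^ k)))"
    then obtain k where "k \<ge> 1" "1 + of_real s * (of_real (q ^ k) * x) = 0"
      unfolding zero by blast
    \<comment> \<open>The factor with exponent k enters on passing from \<open>q ^ k * x\<close> to
      \<open>q ^ (k - 1) * x\<close>, so the zero appears there and is then carried back to
      \<open>x\<close>. The first such factor has exponent 1, whence k \<ge> 1.\<close>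
    hence "gen (of_real (q ^ (k - 1)) * x) = 0"
      using step[of "of_real (q ^ (k - 1)) * x"]
      by (cases k) (simp_all add: mult.assoc)
    moreover have "gen (of_real (q ^ j) * x) = 0 \<Longrightarrow> gen x = 0" for j
    proof (induction j)
      case (Suc j)
      then show ?case
        using step[of "of_real (q ^ j) * x"] by (simp add: mult.assoc)
    qed simp
    ultimately show "gen x = 0" by blast
  qed
next
  case False
  hence q1: "1 < q" using q_neq by simp
  have rad: "ereal (cmod (x / of_real (q ^ k))) < radius" for k
  proof -
    have "cmod x / q ^ k \<le> cmod x"
      using q1 by (intro divide_le_eq_1[THEN iffD2] mult_imp_div_pos_le) (auto simp: mult_le_cancel_left1)
    thus ?thesis using x q1
      by (metis abs_of_pos ereal_less_eq(3) norm_divide norm_of_real order_le_less_trans q_pos zero_less_power)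
  qed
  \<comment> \<open>For q > 1 it is division by q that shrinks the argument, and in this direction
    the functional equation hands a zero on without any division by its factor. Hence there are no
    exceptional points.\<close>
  have "gen x \<noteq> 0"
  proof
    assume 0: "gen x = 0"
    have "gen (x / of_real (q ^ k)) = 0" for k
    proof (induction k)
      case (Suc k)
      have "x / of_real (q ^ Suc k) = x / of_real (q ^ k) / of_real q" by (simp add: field_simps)
      then show ?case
        using gen_div_q[of "x / of_real (q ^ k)"] rad[of k] rad[of "Suc k"] Suc
          by (simp add: mult.commute)
    qed (use 0 in simp)
    moreover have "(\<lambda>k. gen (x * of_real ((1 / q) ^ k))) \<longlonglongrightarrow> gen (x * of_real 0)"
    proof (rule isCont_tendsto_compose[OF isCont_gen])
      show "ereal (cmod (x * complex_of_real 0)) < radius"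
        using le_less_trans[of 0 "ereal (cmod x)", OF _ x] by (simp add: zero_ereal_def)
    qed (use q1 in \<open>intro tendsto_intros LIMSEQ_realpow_zero; simp\<close>)
    ultimately show False by (simp add: LIMSEQ_const_iff power_divide)
  qed
  thus ?thesis using False by simp
qed

section \<open>Overlaps, normalization, eigenvectors and continuity\<close>

lemma coh_domain_iff: "z \<in> coh_domain q l lam \<longleftrightarrow> ereal ((cmod z)\<^sup>2) < radius"
  by (simp add: coh_domain_def)

text \<open>The argument of \<open>gen\<close> in an overlap stays within its disc of convergence: a
  product of two moduli is at most the larger of the squares.\<close>

lemma coh_domain_mult:
  assumes "z1 \<in> coh_domain q l lam" "z2 \<in> coh_domain q l lam"
  shows "ereal (cmod (cnj z1 * z2)) < radius"
proof -
  have "cmod z1 * cmod z2 \<le> max ((cmod z1)\<^sup>2) ((cmod z2)\<^sup>2)"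
    unfolding power2_eq_square
    by (metis linorder_linear max.coboundedI1 max.coboundedI2 mult_mono norm_ge_zero)
  hence "ereal (cmod (cnj z1 * z2)) \<le> max (ereal ((cmod z1)\<^sup>2)) (ereal ((cmod z2)\<^sup>2))"
    by (simp add: norm_mult flip: ereal_max)
  thus ?thesis
    by (rule le_less_trans) (use assms in \<open>simp only: max_less_iff_conj coh_domain_iff\<close>)
qed

lemma coh_coeff_sq_summable:
  assumes "z \<in> coh_domain q l lam"
  shows "coh_coeff q l lam z \<in> sq_summable"
  unfolding sq_summable_def coh_coeff_eq
  using summable_w[of "(cmod z)\<^sup>2"] assms w_pos
  by (simp add: coh_domain_iff norm_mult norm_power power_mult_distrib less_imp_le
      flip: power_mult) (simp add: mult.commute)

lemma coord_coherent_state: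
  assumes "z \<in> coh_domain q l lam"
  shows "coord (ket z) n =
    of_real (N ((cmod z)\<^sup>2) powr (-1/2)) * (of_real (sqrt (w n)) * z ^ n)"
  using coh_coeff_sq_summable[OF assms] number_state_expansion[OF coh_coeff_sq_summable[OF assms]]
  by (simp add: coherent_state_def sums_iff scaleR_fock.rep_eq Fock_inverse coh_coeff_eq)

lemma cinner_coherent_state:
  assumes "z \<in> coh_domain q l lam"
  shows "cinner (ket z) \<psi> = of_real (N ((cmod z)\<^sup>2) powr (-1/2)) *
    (\<Sum>n. of_real (sqrt (w n)) * cnj z ^ n * coord \<psi> n)"
    and "summable (\<lambda>n. of_real (sqrt (w n)) * cnj z ^ n * coord \<psi> n)"
proof -
  let ?N = "N ((cmod z)\<^sup>2) powr (-1/2)"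
  have N: "?N \<noteq> 0"
    using coh_norm_ge_1[of "(cmod z)\<^sup>2"] assms by (simp add: coh_domain_iff)
  have eq: "cnj (coord (ket z) n) * coord \<psi> n =
      of_real ?N * (of_real (sqrt (w n)) * cnj z ^ n * coord \<psi> n)" for n
    by (simp add: coord_coherent_state[OF assms])
  show sm: "summable (\<lambda>n. of_real (sqrt (w n)) * cnj z ^ n * coord \<psi> n)"
    using summable_cinner[of "ket z" \<psi>] N unfolding eq by (simp add: summable_cmult_iff)
  show "cinner (ket z) \<psi> = of_real ?N * (\<Sum>n. of_real (sqrt (w n)) * cnj z ^ n * coord \<psi> n)"
    unfolding cinner_def eq by (rule suminf_mult[OF sm])
qed

lemma coherent_state_overlap:
  assumes "z1 \<in> coh_domain q l lam" "z2 \<in> coh_domain q l lam"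
  shows "cinner (ket z1) (ket z2) =
    of_real (N ((cmod z1)\<^sup>2) powr (-1/2) * N ((cmod z2)\<^sup>2) powr (-1/2)) * gen (cnj z1 * z2)"
proof -
  have "of_real (sqrt (w n)) * cnj z1 ^ n * coord (ket z2) n =
      of_real (N ((cmod z2)\<^sup>2) powr (-1/2)) * (of_real (w n) * (cnj z1 * z2) ^ n)" for n
  proof -
    have "complex_of_real (w n) = of_real (sqrt (w n)) * of_real (sqrt (w n))"
      using w_pos[of n] by (simp flip: of_real_mult)
    thus ?thesis
      by (simp add: coord_coherent_state[OF assms(2)] power_mult_distrib)
  qed
  thus ?thesis
    using suminf_mult[OF summable_w_complex[OF coh_domain_mult[OF assms]]]
    by (simp add: cinner_coherent_state[OF assms(1)] gen_def)
qed

lemma coherent_state_normalized: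
  assumes "z \<in> coh_domain q l lam"
  shows "cinner (ket z) (ket z) = 1"
proof -
  have N: "N ((cmod z)\<^sup>2) > 0"
    using coh_norm_ge_1[of "(cmod z)\<^sup>2"] assms by (simp add: coh_domain_iff)
  have "cnj z * z = of_real ((cmod z)\<^sup>2)"
    by (metis complex_norm_square mult.commute)
  hence "gen (cnj z * z) = of_real (N ((cmod z)\<^sup>2))"
    using assms by (simp add: gen_of_real coh_domain_iff del: of_real_power)
  hence "cinner (ket z) (ket z) = of_real (N ((cmod z)\<^sup>2) powr (-1/2) * N ((cmod z)\<^sup>2) powr (-1/2) *
      N ((cmod z)\<^sup>2))"
    by (simp add: coherent_state_overlap[OF assms assms])
  also have "N ((cmod z)\<^sup>2) powr (-1/2) * N ((cmod z)\<^sup>2) powr (-1/2) * N ((cmod z)\<^sup>2) = 1"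
    using N by (simp add: powr_minus field_simps flip: powr_add)
  finally show ?thesis by simp
qed

lemma coherent_state_eigenvector:
  assumes "z \<in> coh_domain q l lam"
  shows "ket z \<in> ann_domain q l lam" and "ann q l lam (ket z) = z *\<^sub>C ket z"
proof -
  have eq: "(\<lambda>n. complex_of_real (ann_coeff q l lam (Suc n)) * coord (ket z) (Suc n)) =
      coord (z *\<^sub>C ket z)"
  proof
    fix n
    have "complex_of_real (ann_coeff q l lam (Suc n)) * of_real (sqrt (w (Suc n))) = of_real (sqrt (w n))"
      using ann_coeff_w[of n] by (simp flip: of_real_mult)
    thus "complex_of_real (ann_coeff q l lam (Suc n)) * coord (ket z) (Suc n) = coord (z *\<^sub>C ket z) n"
      by (simp add: coord_coherent_state[OF assms] cscale.rep_eq algebra_simps)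
  qed
  show "ket z \<in> ann_domain q l lam"
    unfolding ann_domain_def mem_Collect_eq eq by (rule coord)
  show "ann q l lam (ket z) = z *\<^sub>C ket z"
    unfolding ann_def eq by (rule coord_inverse)
qed

lemma coherent_state_orthogonal_iff:
  assumes "z1 \<in> coh_domain q l lam" "z2 \<in> coh_domain q l lam"
  shows "cinner (ket z1) (ket z2) = 0 \<longleftrightarrow>
    q < 1 \<and> (\<exists>k::nat. k \<ge> 1 \<and> cnj z1 * z2 = of_real (- c / ((1 - q) * q ^ k)))"
proof -
  have "N ((cmod z1)\<^sup>2) > 0" "N ((cmod z2)\<^sup>2) > 0"
    using coh_norm_ge_1[of "(cmod z1)\<^sup>2"] coh_norm_ge_1[of "(cmod z2)\<^sup>2"] assms
    by (simp_all add: coh_domain_iff)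
  thus ?thesis
    unfolding coherent_state_overlap[OF assms] gen_eq_0_iff[OF coh_domain_mult[OF assms], symmetric]
    by simp
qed

lemma isCont_coh_norm:
  assumes "ereal \<bar>x\<bar> < radius"
  shows "isCont N x"
proof -
  obtain r where r: "\<bar>x\<bar> < r" "ereal r < radius"
    using assms ereal_dense2 by (metis less_ereal.simps(1))
  have "isCont (\<lambda>x. \<Sum>n. w n * x ^ n) x"
    using r by (intro isCont_powser[where K = r] summable_w) auto
  thus ?thesis by (simp add: coh_norm_eq[abs_def])
qed

text \<open>For fixed \<open>z\<close> the distance from \<open>ket y\<close> to
  \<open>ket z\<close> is an explicit continuous function of \<open>N\<close> and
  \<open>gen\<close>, and it vanishes at \<open>y = z\<close>; no estimate of the vector series is
  involved.\<close>

lemma continuous_on_coherent_state: "continuous_on (coh_domain q l lam) ket"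
  unfolding continuous_on_def
proof
  fix z assume z: "z \<in> coh_domain q l lam"
  let ?D = "coh_domain q l lam"
  have cN: "continuous_on ?D (\<lambda>y. N ((cmod y)\<^sup>2))"
    by (intro continuous_at_imp_continuous_on ballI isCont_o2[OF _ isCont_coh_norm] continuous_intros)
       (simp add: coh_domain_iff)
  have "continuous_on ?D (\<lambda>y. gen (cnj y * z))"
  proof (rule continuous_on_compose2[of "(\<lambda>y. cnj y * z) ` ?D" gen])
    show "continuous_on ((\<lambda>y. cnj y * z) ` ?D) gen"
      using coh_domain_mult[OF _ z] by (intro continuous_at_imp_continuous_on ballI isCont_gen) auto
  qed (auto intro!: continuous_intros)
  moreover have "N ((cmod y)\<^sup>2) \<noteq> 0" if "y \<in> ?D" for y
    using coh_norm_ge_1[of "(cmod y)\<^sup>2"] that by (auto simp: coh_domain_iff)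
  ultimately have "continuous_on ?D (\<lambda>y. sqrt (2 - 2 * Re (
      of_real (N ((cmod y)\<^sup>2) powr (-1/2) * N ((cmod z)\<^sup>2) powr (-1/2)) * gen (cnj y * z))))"
    using cN by (intro continuous_intros) auto
  hence "continuous_on ?D (\<lambda>y. dist (ket y) (ket z))"
    by (rule continuous_on_eq)
       (simp only: dist_unit_vectors coherent_state_normalized coherent_state_overlap z)
  hence "((\<lambda>y. dist (ket y) (ket z)) \<longlongrightarrow> dist (ket z) (ket z)) (at z within ?D)"
    using z unfolding continuous_on_def by blast
  thus "(ket \<longlongrightarrow> ket z) (at z within ?D)"
    by (simp add: tendsto_dist_iff[of ket])
qed

section \<open>Bounds and sesquilinear form used in both resolutions of unity\<close>

lemma coh_norm_mono:
  assumes "0 \<le> x" "x \<le> y" "ereal y < radius"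
  shows "N x \<le> N y"
proof -
  have "ereal x < radius"
    using assms by (metis ereal_less_eq(3) order_le_less_trans)
  thus ?thesis
    unfolding coh_norm_eq using assms w_pos
    by (intro suminf_le summable_w) (auto intro!: mult_left_mono power_mono simp: less_imp_le)
qed

lemma amplitude_sq_summable:
  assumes "0 \<le> r" "ereal (r\<^sup>2) < radius"
  shows "(\<lambda>n. of_real (sqrt (w n) * r ^ n)) \<in> sq_summable"
  using summable_w[of "r\<^sup>2"] assms w_pos
  by (simp add: sq_summable_def norm_mult norm_power power_mult_distrib less_imp_le
      flip: power_mult) (simp add: mult.commute)

lemma summable_coord_amplitude:
  assumes "0 \<le> r" "ereal (r\<^sup>2) < radius"
  shows "summable (\<lambda>n. norm (coord \<phi> n * of_real (sqrt (w n) * r ^ n)))"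
  by (intro summable_prod_norm coord amplitude_sq_summable assms)

text \<open>Exhibits the matrix element as a product of two scalar overlaps, the shape to which
  polarization and Parseval apply.\<close>

lemma cinner_ketbra:
  "cinner \<phi> (coh_ketbra q l lam z \<psi>) = cinner (ket z) \<psi> * cnj (cinner (ket z) \<phi>)"
  unfolding coh_ketbra_def by (metis cinner_cscale_right cinner_commute)

end

section \<open>Resolution of unity for \<open>q < 1\<close>\<close>

locale coherent_states_lt1 = coherent_states +
  assumes q_lt1: "q < 1"
begin

section \<open>The density \<open>h\<close> and its moments\<close>

lemma radius_eq [simp]: "radius = \<infinity>"
  using q_lt1 by (simp add: coh_radius_def)

lemma s_pos: "0 < s"
  using q_lt1 c_pos by (simp add: s_def)

definition h :: "real \<Rightarrow> real" where "h x = 1 / N (x / q)"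

lemma N_pos: "0 \<le> x \<Longrightarrow> 0 < N x"
  using coh_norm_ge_1[of x] by simp

lemma h_pos: "0 \<le> x \<Longrightarrow> 0 < h x"
  using N_pos[of "x / q"] q_pos by (simp add: h_def)

lemma N_h: "0 \<le> x \<Longrightarrow> N x * h x = 1 / (1 + s * x)"
  using coh_norm_div_q[of x] N_pos[of x] by (simp add: h_def)

lemma h_scale:
  assumes "0 \<le> x"
  shows "h (q * x) = (1 + s * x) * h x"
  using coh_norm_div_q[of x] N_pos[of x] assms q_pos s_pos
  by (simp add: h_def add_nonneg_eq_0_iff)

lemma h_0 [simp]: "h 0 = 1"
  by (simp add: h_def coh_norm_eq)

lemma isCont_h: "0 \<le> x \<Longrightarrow> isCont h x"
  unfolding h_def
  using N_pos[of "x / q"] q_pos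
  by (intro continuous_intros isCont_o2[OF _ isCont_coh_norm]) auto

lemma h_antimono: "0 \<le> x \<Longrightarrow> x \<le> y \<Longrightarrow> h y \<le> h x"
  unfolding h_def using q_pos N_pos[of "x / q"]
  by (intro divide_left_mono coh_norm_mono mult_pos_pos N_pos divide_right_mono) auto

lemma borel_measurable_coh_norm [measurable]: "N \<in> borel_measurable borel"
  by (intro borel_measurable_continuous_onI continuous_at_imp_continuous_on ballI isCont_coh_norm) simp

lemma borel_measurable_h [measurable]: "h \<in> borel_measurable borel"
  unfolding h_def by measurable

text \<open>Since \<open>N\<close> is at least 1, the identity for \<open>N x * h x\<close> bounds
  \<open>h x\<close> by 1 / (1 + s x). This majorant is not integrable, so integrability of
  \<open>h\<close> has to come from an antiderivative.\<close>

lemma h_at_top: "(h \<longlongrightarrow> 0) at_top"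
proof (rule tendsto_sandwich)
  show "eventually (\<lambda>x. 0 \<le> h x) at_top"
    using eventually_ge_at_top[of 0] by eventually_elim (simp add: h_pos less_imp_le)
  show "eventually (\<lambda>x. h x \<le> inverse (1 + s * x)) at_top"
    using eventually_ge_at_top[of 0]
  proof eventually_elim
    case (elim x)
    have "1 * h x \<le> N x * h x"
      using elim coh_norm_ge_1[of x] by (intro mult_right_mono) (simp_all add: h_pos less_imp_le)
    thus ?case using N_h[OF elim] by (simp add: inverse_eq_divide)
  qed
  have "filterlim (\<lambda>x. 1 + s * x) at_top at_top"
    using s_pos
    by (intro filterlim_tendsto_add_at_top[OF tendsto_const]
          filterlim_tendsto_pos_mult_at_top[OF tendsto_const] filterlim_ident)
  thus "((\<lambda>x. inverse (1 + s * x)) \<longlongrightarrow> 0) at_top"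
    by (rule tendsto_inverse_0_at_top)
qed simp

text \<open>A Frullani integral: the functional equation reads \<open>s * h x = (h (q * x) - h x) / x\<close>, so an
  antiderivative \<open>P\<close> of \<open>h x / x\<close> yields the antiderivative \<open>(P (q * x) - P x) / s\<close> of \<open>h\<close>.\<close>

lemma nn_integral_h: "(\<integral>\<^sup>+x. indicator {0<..} x * ennreal (h x) \<partial>lborel) = ennreal (ln (1 / q) / s)"
proof -
  have "\<exists>P. \<forall>x. 0 < ereal x \<longrightarrow> ereal x < \<infinity> \<longrightarrow> (P has_vector_derivative h x / x) (at x)"
    by (rule einterval_antiderivative) (auto intro!: continuous_intros isCont_h)
  then obtain P where P: "\<And>x. 0 < x \<Longrightarrow> (P has_real_derivative h x / x) (at x)"
    by (auto simp: has_real_derivative_iff_has_vector_derivative)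
  define H where "H x = (P (q * x) - P x) / s" for x
  have H: "(H has_real_derivative h x) (at x)" if x: "0 < x" for x
  proof -
    have "((\<lambda>x. P (q * x)) has_real_derivative (h (q * x) / (q * x)) * q) (at x)"
      using x q_pos by (intro DERIV_chain2[OF P]) (auto intro!: derivative_eq_intros)
    hence "(H has_real_derivative ((h (q * x) / (q * x)) * q - h x / x) / s) (at x)"
      unfolding H_def by (intro DERIV_cdivide DERIV_diff P x)
    also have "((h (q * x) / (q * x)) * q - h x / x) / s = h x"
      using x q_pos s_pos by (simp add: h_scale field_simps)
    finally show ?thesis .
  qed
  have bounds: "- h (q * x) * ln (1 / q) / s \<le> H x" "H x \<le> - h x * ln (1 / q) / s" if x: "0 < x" for x
  proof -
    have qx: "q * x < x" "0 < q * x" using q_pos q_lt1 x by auto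
    \<comment> \<open>\<open>P\<close> diverges logarithmically at 0, but its increment over
      [q x, x] does not: Cauchy's mean value theorem against \<open>ln\<close> gives h t * ln (1 /
      q) at some t in between. Both limits of \<open>H\<close> thus reduce to those of
      \<open>h\<close>.\<close>
    have "\<exists>t>q * x. t < x \<and> (P x - P (q * x)) * (1 / t) = (ln x - ln (q * x)) * (h t / t)"
    proof (rule GMVT')
      show "isCont P t" if "q * x \<le> t" "t \<le> x" for t
        using that qx by (intro DERIV_isCont[OF P]) auto
      show "isCont ln t" if "q * x \<le> t" "t \<le> x" for t :: real
        using that qx by (intro isCont_ln) auto
      show "(ln has_real_derivative 1 / t) (at t)" if "q * x < t" "t < x" for t
        using that qx by (intro DERIV_ln_divide) auto
      show "(P has_real_derivative h t / t) (at t)" if "q * x < t" "t < x" for t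
        using that qx by (intro P) auto
    qed (use qx in auto)
    then obtain t where t: "q * x < t" "t < x"
      "(P x - P (q * x)) * (1 / t) = (ln x - ln (q * x)) * (h t / t)" by blast
    have "ln x - ln (q * x) = ln (1 / q)"
      using x q_pos by (simp add: ln_mult ln_div)
    hence "P x - P (q * x) = h t * ln (1 / q)"
      using t(3) order.strict_trans[OF qx(2) t(1)] by simp
    moreover have "H x = - (P x - P (q * x)) / s"
      by (simp add: H_def)
    ultimately have Hx: "H x = - h t * ln (1 / q) / s"
      by (simp only: mult_minus_left)
    have "h x \<le> h t" "h t \<le> h (q * x)"
      using t qx by (auto intro!: h_antimono)
    moreover have "0 \<le> ln (1 / q)"
      using q_pos q_lt1 by simp
    ultimately show "- h (q * x) * ln (1 / q) / s \<le> H x" "H x \<le> - h x * ln (1 / q) / s"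
      unfolding Hx using s_pos by (auto intro!: divide_right_mono mult_right_mono)
  qed
  have H0: "(H \<longlongrightarrow> - ln (1 / q) / s) (at_right 0)"
  proof (rule tendsto_sandwich)
    have "((\<lambda>x. - h (q * x) * ln (1 / q) / s) \<longlongrightarrow> - h (q * 0) * ln (1 / q) / s) (at_right 0)"
      using s_pos by (intro tendsto_intros isCont_tendsto_compose[OF isCont_h]) auto
    thus "((\<lambda>x. - h (q * x) * ln (1 / q) / s) \<longlongrightarrow> - ln (1 / q) / s) (at_right 0)"
      by simp
    have "((\<lambda>x. - h x * ln (1 / q) / s) \<longlongrightarrow> - h 0 * ln (1 / q) / s) (at_right 0)"
      using s_pos by (intro tendsto_intros isCont_tendsto_compose[OF isCont_h]) auto
    thus "((\<lambda>x. - h x * ln (1 / q) / s) \<longlongrightarrow> - ln (1 / q) / s) (at_right 0)"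
      by simp
  qed (use eventually_at_right_less[of 0] in \<open>eventually_elim, use bounds in auto\<close>)+
  have Hinf: "(H \<longlongrightarrow> 0) at_top"
  proof (rule tendsto_sandwich)
    have "((\<lambda>x. - h (q * x) * ln (1 / q) / s) \<longlongrightarrow> - 0 * ln (1 / q) / s) at_top"
      using s_pos q_pos
      by (intro tendsto_intros filterlim_compose[OF h_at_top]
            filterlim_tendsto_pos_mult_at_top[OF tendsto_const] filterlim_ident) auto
    thus "((\<lambda>x. - h (q * x) * ln (1 / q) / s) \<longlongrightarrow> 0) at_top"
      by simp
    have "((\<lambda>x. - h x * ln (1 / q) / s) \<longlongrightarrow> - 0 * ln (1 / q) / s) at_top"
      using s_pos by (intro tendsto_intros h_at_top) auto
    thus "((\<lambda>x. - h x * ln (1 / q) / s) \<longlongrightarrow> 0) at_top"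
      by simp
  qed (use eventually_gt_at_top[of 0] in \<open>eventually_elim, use bounds in auto\<close>)+
  have A: "((H \<circ> real_of_ereal) \<longlongrightarrow> - ln (1 / q) / s) (at_right 0)"
    using H0 unfolding zero_ereal_def ereal_tendsto_simps1 .
  have B: "((H \<circ> real_of_ereal) \<longlongrightarrow> 0) (at_left \<infinity>)"
    using Hinf unfolding ereal_tendsto_simps1 .
  \<comment> \<open>Nonnegativity of \<open>h\<close> lets the limits of \<open>H\<close> at the two
    ends deliver integrability together with the value.\<close>
  have int: "set_integrable lborel (einterval 0 \<infinity>) h"
    by (rule interval_integral_FTC_nonneg(1)[OF _ _ _ _ A B])
       (auto intro!: H isCont_h AE_I2 less_imp_le[OF h_pos])
  have eq: "(LBINT x=0..\<infinity>. h x) = 0 - (- ln (1 / q) / s)"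
    by (rule interval_integral_FTC_nonneg(2)[OF _ _ _ _ A B])
       (auto intro!: H isCont_h AE_I2 less_imp_le[OF h_pos])
  have ei: "einterval 0 \<infinity> = {0<..}"
    by (auto simp: einterval_def)
  have "(\<integral>\<^sup>+x. indicator {0<..} x * ennreal (h x) \<partial>lborel) =
      (\<integral>\<^sup>+x. ennreal (indicator {0<..} x *\<^sub>R h x) \<partial>lborel)"
    by (intro nn_integral_cong) (auto split: split_indicator)
  also have "\<dots> = ennreal (LBINT x:{0<..}. h x)"
    using int unfolding set_integrable_def set_lebesgue_integral_def ei
    by (intro nn_integral_eq_integral) (auto intro!: AE_I2 less_imp_le[OF h_pos] split: split_indicator)
  also have "(LBINT x:{0<..}. h x) = ln (1 / q) / s"
    using eq by (simp add: interval_lebesgue_integral_def ei)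
  finally show ?thesis .
qed

text \<open>Substituting q x for x and applying \<open>h_scale\<close> expresses the n-th moment J n
  as q^(n+1) (J n + s J (n+1)). Solved for J (n+1), this is \<open>w_rec\<close> for the reciprocal
  weights.\<close>

lemma nn_integral_moment:
  "(\<integral>\<^sup>+x. indicator {0<..} x * ennreal (x ^ n * h x) \<partial>lborel) = ennreal (ln (1 / q) / (s * w n))"
proof (induction n)
  case 0
  then show ?case by (simp add: nn_integral_h)
next
  case (Suc n)
  let ?J = "\<lambda>n. \<integral>\<^sup>+x. indicator {0<..} x * ennreal (x ^ n * h x) \<partial>lborel"
  have L: "0 \<le> ln (1 / q)" using q_pos q_lt1 by simp
  have Q: "0 < q ^ Suc n" "q ^ Suc n < 1"
    using q_pos q_lt1 power_Suc_less_one[of q n] by auto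
  have "?J n = q * (\<integral>\<^sup>+x. indicator {0<..} (0 + q * x) * ennreal ((0 + q * x) ^ n * h (0 + q * x)) \<partial>lborel)"
    using q_pos by (subst nn_integral_real_affine[where c = q and t = 0]) auto
  also have "\<dots> = q * (\<integral>\<^sup>+x. ennreal (q ^ n) *
      (indicator {0<..} x * ennreal (x ^ n * h x) + ennreal s * (indicator {0<..} x * ennreal (x ^ Suc n * h x))) \<partial>lborel)"
  proof (rule arg_cong[where f = "\<lambda>I. ennreal q * I"], rule nn_integral_cong)
    fix x :: real
    show "indicator {0<..} (0 + q * x) * ennreal ((0 + q * x) ^ n * h (0 + q * x)) = ennreal (q ^ n) *
      (indicator {0<..} x * ennreal (x ^ n * h x) + ennreal s * (indicator {0<..} x * ennreal (x ^ Suc n * h x)))"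
    proof (cases "0 < x")
      case True
      hence "(q * x) ^ n * h (q * x) = q ^ n * (x ^ n * h x + s * (x ^ Suc n * h x))"
        by (simp add: h_scale algebra_simps power_mult_distrib)
      thus ?thesis
        using True q_pos s_pos h_pos[of x]
        by (simp add: zero_less_mult_iff ennreal_mult flip: ennreal_plus)
           (simp add: ennreal_mult[symmetric] less_imp_le)
    qed (use q_pos in \<open>auto simp: zero_less_mult_iff\<close>)
  qed
  also have "\<dots> = ennreal (q ^ Suc n) * (?J n + ennreal s * ?J (Suc n))"
    using q_pos by (simp add: nn_integral_cmult nn_integral_add ennreal_mult mult.assoc)
  finally have eq: "?J n = ennreal (q ^ Suc n) * (?J n + ennreal s * ?J (Suc n))" .
  define j where "j = ln (1 / q) / (s * w n)"
  have j: "0 \<le> j" "?J n = ennreal j"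
    using Suc L s_pos w_pos[of n] by (simp_all add: j_def)
  \<comment> \<open>Subtraction is legitimate only for finite values; an infinite new moment would
    force the previous one to be infinite.\<close>
  have "?J (Suc n) \<noteq> \<infinity>"
  proof
    assume "?J (Suc n) = \<infinity>"
    hence "ennreal (q ^ Suc n) * (?J n + ennreal s * ?J (Suc n)) = \<infinity>"
      using Q s_pos q_pos by (simp add: ennreal_mult_eq_top_iff del: power_Suc)
    thus False
      using eq j(2) by (simp del: power_Suc)
  qed
  then obtain j' where j': "0 \<le> j'" "?J (Suc n) = ennreal j'"
    by (metis ennreal_cases infinity_ennreal_def)
  have "ennreal (q ^ Suc n) * (ennreal j + ennreal s * ennreal j') = ennreal (q ^ Suc n * (j + s * j'))"
    using Q s_pos j(1) j'(1) by (simp add: ennreal_mult ennreal_plus del: power_Suc)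
  hence "ennreal j = ennreal (q ^ Suc n * (j + s * j'))"
    using eq unfolding j(2) j'(2) by (simp only:)
  hence "j = q ^ Suc n * (j + s * j')"
    using Q s_pos j j' by (subst (asm) ennreal_inj) auto
  hence "j' * (s * q ^ Suc n) = j * (1 - q ^ Suc n)"
    by (simp add: algebra_simps del: power_Suc)
  hence "j' = j * (1 - q ^ Suc n) / (s * q ^ Suc n)"
    using s_pos q_pos by (simp add: nonzero_eq_divide_eq del: power_Suc)
  also have "\<dots> = j * ((1 - q ^ Suc n) / (s * q ^ Suc n))"
    by simp
  also have "(1 - q ^ Suc n) / (s * q ^ Suc n) = w n / w (Suc n)"
    using w_rec[of n] w_pos[of "Suc n"] s_pos q_pos
    by (subst frac_eq_eq) (auto simp: mult.commute simp del: power_Suc)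
  also have "j * (w n / w (Suc n)) = ln (1 / q) / (s * w (Suc n))"
    using w_pos[of n] by (simp add: j_def)
  finally show ?case using j' by simp
qed

section \<open>Diagonal matrix elements and polarization\<close>

lemma coh_measure_eq:
  "coh_measure q l lam = density lborel (\<lambda>z. ennreal (s / (pi * ln (1 / q)) * (N ((cmod z)\<^sup>2) * h ((cmod z)\<^sup>2))))"
  unfolding coh_measure_def
  by (intro arg_cong2[where f = density] refl ext)
     (simp add: coh_domain_def s_def c_def h_def inverse_eq_divide mult_ac)

lemma nn_integral_coherent_state:
  "(\<integral>\<^sup>+z. ennreal ((cmod (cinner (ket z) \<eta>))\<^sup>2) \<partial>coh_measure q l lam) = ennreal ((norm \<eta>)\<^sup>2)"
  and borel_measurable_cinner_ket: "(\<lambda>z. cinner (ket z) \<eta>) \<in> borel_measurable borel"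
proof -
  \<comment> \<open>The overlap of \<open>ket z\<close> with \<eta> is a power series in
    \<open>cnj z\<close>; conjugated coefficients turn it into one in \<open>z\<close> with the same
    modulus.\<close>
  define a where "a n = cnj (coord \<eta> n) * of_real (sqrt (w n))" for n
  define K where "K x = ennreal (s / (pi * ln (1 / q)) * h x)" for x
  have L: "0 < ln (1 / q)" using q_pos q_lt1 by simp
  have dom: "z \<in> coh_domain q l lam" for z by (simp add: coh_domain_iff)
  have sa: "summable (\<lambda>n. norm (a n * of_real r ^ n))" for r
    using summable_coord_amplitude[of "\<bar>r\<bar>" \<eta>] by (simp add: a_def norm_mult norm_power mult.assoc)
  define A where "A z = (\<Sum>n. a n * z ^ n)" for z
  have "isCont A z" for z
    unfolding A_def
    by (rule isCont_powser[where K = "of_real (cmod z + 1)"])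
       (use sa[of "cmod z + 1", THEN summable_norm_cancel] in auto)
  hence [measurable]: "A \<in> borel_measurable borel"
    by (intro borel_measurable_continuous_onI continuous_at_imp_continuous_on) auto
  have ket_A: "cinner (ket z) \<eta> = of_real (N ((cmod z)\<^sup>2) powr (-1/2)) * cnj (A z)" for z
  proof -
    have "(\<lambda>n. a n * z ^ n) sums A z"
      unfolding A_def
      by (rule summable_sums[OF summable_norm_cancel])
         (use sa[of "cmod z"] in \<open>simp add: norm_mult norm_power\<close>)
    hence "(\<lambda>n. cnj (a n * z ^ n)) sums cnj (A z)"
      by (simp only: sums_cnj)
    thus ?thesis
      by (simp add: cinner_coherent_state[OF dom] a_def sums_iff mult_ac)
  qed
  show meas: "(\<lambda>z. cinner (ket z) \<eta>) \<in> borel_measurable borel"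
  proof -
    have [measurable]: "cnj \<in> borel_measurable borel"
      by (intro borel_measurable_continuous_onI continuous_intros)
    show ?thesis unfolding ket_A by measurable
  qed
  have "(\<integral>\<^sup>+z. ennreal ((cmod (cinner (ket z) \<eta>))\<^sup>2) \<partial>coh_measure q l lam) =
      (\<integral>\<^sup>+z. ennreal ((cmod (A z))\<^sup>2) * K ((cmod z)\<^sup>2) \<partial>lborel)"
    unfolding coh_measure_eq
  proof (subst nn_integral_density)
    have "ennreal (s / (pi * ln (1 / q)) * (N ((cmod z)\<^sup>2) * h ((cmod z)\<^sup>2))) * ennreal ((cmod (cinner (ket z) \<eta>))\<^sup>2) =
        ennreal ((cmod (A z))\<^sup>2) * K ((cmod z)\<^sup>2)" for z
    proof -
      let ?n = "N ((cmod z)\<^sup>2)"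
      have n: "0 < ?n" by (simp add: N_pos)
      hence "(?n powr (-1/2))\<^sup>2 * ?n = 1"
        by (simp add: power2_eq_square powr_minus field_simps flip: powr_add)
      moreover have "?n * (cmod (cinner (ket z) \<eta>))\<^sup>2 = ((?n powr (-1/2))\<^sup>2 * ?n) * (cmod (A z))\<^sup>2"
        unfolding ket_A by (simp add: norm_mult power_mult_distrib)
      ultimately have eq: "?n * (cmod (cinner (ket z) \<eta>))\<^sup>2 = (cmod (A z))\<^sup>2"
        by simp
      show ?thesis
        unfolding K_def using n L s_pos h_pos[of "(cmod z)\<^sup>2"]
        by (subst (1 2) ennreal_mult[symmetric]) (auto simp: eq)
    qed
    thus "(\<integral>\<^sup>+z. ennreal (s / (pi * ln (1 / q)) * (N ((cmod z)\<^sup>2) * h ((cmod z)\<^sup>2))) *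
        ennreal ((cmod (cinner (ket z) \<eta>))\<^sup>2) \<partial>lborel) =
        (\<integral>\<^sup>+z. ennreal ((cmod (A z))\<^sup>2) * K ((cmod z)\<^sup>2) \<partial>lborel)"
      by simp
  qed (use meas in auto)
  also have "\<dots> = (\<Sum>n. ennreal ((cmod (a n))\<^sup>2) *
      (ennreal pi * (\<integral>\<^sup>+x. indicator {0<..} x * (ennreal (x ^ n) * K x) \<partial>lborel)))"
    unfolding A_def by (rule nn_integral_powser_norm_sq[OF sa]) (simp add: K_def)
  also have "\<dots> = (\<Sum>n. ennreal ((cmod (coord \<eta> n))\<^sup>2))"
  proof (intro suminf_cong)
    fix n
    have "(\<integral>\<^sup>+x. indicator {0<..} x * (ennreal (x ^ n) * K x) \<partial>lborel) =
        (\<integral>\<^sup>+x. ennreal (s / (pi * ln (1 / q))) * (indicator {0<..} x * ennreal (x ^ n * h x)) \<partial>lborel)"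
    proof (intro nn_integral_cong)
      show "indicator {0<..} x * (ennreal (x ^ n) * K x) =
          ennreal (s / (pi * ln (1 / q))) * (indicator {0<..} x * ennreal (x ^ n * h x))" for x
        unfolding K_def using L s_pos h_pos[of x]
        by (cases "0 < x") (auto simp: ennreal_mult[symmetric] mult_ac less_imp_le simp del: times_divide_eq_left times_divide_eq_right)
    qed
    also have "\<dots> = ennreal (s / (pi * ln (1 / q)) * (ln (1 / q) / (s * w n)))"
      using L s_pos w_pos[of n]
      by (simp add: nn_integral_cmult nn_integral_moment ennreal_mult[symmetric] less_imp_le)
    \<comment> \<open>The constant in the measure is 1 over pi times the zeroth moment; the radial
      formula returns the pi, and only the weight survives.\<close>
    also have "s / (pi * ln (1 / q)) * (ln (1 / q) / (s * w n)) = 1 / (pi * w n)"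
      using L s_pos by simp
    finally have I: "ennreal pi * (\<integral>\<^sup>+x. indicator {0<..} x * (ennreal (x ^ n) * K x) \<partial>lborel) = ennreal (1 / w n)"
      using w_pos[of n] by (simp add: ennreal_mult[symmetric] less_imp_le)
    show "ennreal ((cmod (a n))\<^sup>2) *
      (ennreal pi * (\<integral>\<^sup>+x. indicator {0<..} x * (ennreal (x ^ n) * K x) \<partial>lborel)) = ennreal ((cmod (coord \<eta> n))\<^sup>2)"
      unfolding I using w_pos[of n]
      by (simp add: a_def norm_mult power_mult_distrib ennreal_mult[symmetric] less_imp_le)
  qed
  also have "\<dots> = ennreal ((norm \<eta>)\<^sup>2)"
    by (subst suminf_ennreal2[OF _ summable_coord_sq])
       (simp_all add: norm_fock_eq suminf_nonneg summable_coord_sq)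
  finally show "(\<integral>\<^sup>+z. ennreal ((cmod (cinner (ket z) \<eta>))\<^sup>2) \<partial>coh_measure q l lam) = ennreal ((norm \<eta>)\<^sup>2)" .
qed

lemma has_bochner_integral_coherent_state:
  "has_bochner_integral (coh_measure q l lam) (\<lambda>z. complex_of_real ((cmod (cinner (ket z) \<eta>))\<^sup>2))
    (complex_of_real ((norm \<eta>)\<^sup>2))"
proof (intro has_bochner_integral_of_real has_bochner_integral_nn_integral)
  show "(\<lambda>z. (cmod (cinner (ket z) \<eta>))\<^sup>2) \<in> borel_measurable (coh_measure q l lam)"
    using borel_measurable_cinner_ket[of \<eta>] by (simp add: coh_measure_eq)
qed (auto simp: nn_integral_coherent_state)

lemma resolves_unity: "resolves_unity_Lebesgue q l lam"
  unfolding resolves_unity_Lebesgue_def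
proof (intro allI)
  fix \<phi> \<psi> :: fock
  let ?P = "\<lambda>\<eta> z. complex_of_real ((cmod (cinner (ket z) \<eta>))\<^sup>2)"
  let ?I = "\<lambda>\<eta>. complex_of_real ((norm \<eta>)\<^sup>2)"
  \<comment> \<open>Polarization over the fourth roots of unity. The root multiplies \<phi>, the
    antilinear slot, so weighting by the same root isolates \<open>cinner \<phi> \<psi>\<close>.
    Integrand and value are both quadratic in \<eta>, and the one identity serves both.\<close>
  have "has_bochner_integral (coh_measure q l lam)
    (\<lambda>z. 1 / 4 * (?P (\<psi> + 1 *\<^sub>C \<phi>) z + (-1) * ?P (\<psi> + (-1) *\<^sub>C \<phi>) z +
      \<i> * ?P (\<psi> + \<i> *\<^sub>C \<phi>) z + (-\<i>) * ?P (\<psi> + (-\<i>) *\<^sub>C \<phi>) z))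
    (1 / 4 * (?I (\<psi> + 1 *\<^sub>C \<phi>) + (-1) * ?I (\<psi> + (-1) *\<^sub>C \<phi>) +
      \<i> * ?I (\<psi> + \<i> *\<^sub>C \<phi>) + (-\<i>) * ?I (\<psi> + (-\<i>) *\<^sub>C \<phi>)))"
    by (intro has_bochner_integral_mult_right has_bochner_integral_add has_bochner_integral_coherent_state)
  also have "1 / 4 * (?I (\<psi> + 1 *\<^sub>C \<phi>) + (-1) * ?I (\<psi> + (-1) *\<^sub>C \<phi>) +
      \<i> * ?I (\<psi> + \<i> *\<^sub>C \<phi>) + (-\<i>) * ?I (\<psi> + (-\<i>) *\<^sub>C \<phi>)) = cinner \<phi> \<psi>"
    unfolding cinner_self_norm[symmetric]
    by (simp add: cinner_add_left cinner_add_right cinner_cscale_left cinner_cscale_right algebra_simps)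
  also have "(\<lambda>z. 1 / 4 * (?P (\<psi> + 1 *\<^sub>C \<phi>) z + (-1) * ?P (\<psi> + (-1) *\<^sub>C \<phi>) z +
      \<i> * ?P (\<psi> + \<i> *\<^sub>C \<phi>) z + (-\<i>) * ?P (\<psi> + (-\<i>) *\<^sub>C \<phi>) z)) =
      (\<lambda>z. cinner \<phi> (coh_ketbra q l lam z \<psi>))"
    unfolding cinner_ketbra complex_norm_square
    by (simp add: cinner_add_right cinner_cscale_right algebra_simps)
  finally show "has_bochner_integral (coh_measure q l lam)
      (\<lambda>z. cinner \<phi> (coh_ketbra q l lam z \<psi>)) (cinner \<phi> \<psi>)" .
qed

end

section \<open>Resolution of unity for \<open>q > 1\<close>\<close>

locale coherent_states_gt1 = coherent_states +
  assumes q_gt1: "1 < q"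
begin

definition R :: real where "R = c / (q - 1)"

text \<open>The terms of the series of \<open>N\<close> at the boundary point \<open>R\<close>; at
  the nodes \<open>R * p ^ k\<close> only powers of \<open>p\<close> are then left over.\<close>

definition W :: "nat \<Rightarrow> real" where "W n = w n * R ^ n"

definition p :: real where "p = 1 / q"

text \<open>Reciprocal of \<open>N\<close> at the k-th node. At k = 0 the series of \<open>N\<close>
  diverges, and 0 is the value that makes \<open>g_rec\<close> hold there as well.\<close>

definition g :: "nat \<Rightarrow> real" where "g k = (if k = 0 then 0 else 1 / N (R * p ^ k))"

lemma p_bounds: "0 < p" "p < 1"
  using q_gt1 by (simp_all add: p_def)

lemma R_pos: "0 < R"
  using q_gt1 c_pos by (simp add: R_def)

lemma s_eq: "s = - 1 / R"
  using q_gt1 c_pos by (simp add: s_def R_def field_simps)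

lemma radius_eq: "radius = ereal R"
  using q_gt1 by (simp add: coh_radius_def R_def c_def)

lemma node_less: "R * p ^ Suc k < R" "0 < R * p ^ k"
  using R_pos p_bounds power_Suc_less_one[of p k] by simp_all

section \<open>Recurrences and moments on the Jackson nodes\<close>

lemma N_pos: "0 \<le> x \<Longrightarrow> x < R \<Longrightarrow> 0 < N x"
  using coh_norm_ge_1[of x] by (simp add: radius_eq)

lemma N_div_q: "0 \<le> x \<Longrightarrow> x < R \<Longrightarrow> N (x / q) = (1 - x / R) * N x"
proof -
  assume x: "0 \<le> x" "x < R"
  hence "x / q \<le> x" using q_gt1 by (simp add: divide_le_eq mult_le_cancel_left1)
  thus ?thesis using x by (simp add: coh_norm_div_q radius_eq s_eq)
qed

lemma W_pos: "0 < W n"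
  using w_pos R_pos by (simp add: W_def)

lemma W_0 [simp]: "W 0 = 1"
  by (simp add: W_def)

lemma W_rec: "W (Suc n) * (1 - p ^ Suc n) = W n"
proof -
  have Q: "0 < q ^ Suc n" using q_pos by simp
  have "w (Suc n) * (1 - p ^ Suc n) = - (w (Suc n) * (1 - q ^ Suc n)) / q ^ Suc n"
  proof -
    have "p ^ Suc n * q ^ Suc n = 1"
      using q_pos by (simp only: power_mult_distrib[symmetric]) (simp add: p_def)
    hence "w (Suc n) * (1 - p ^ Suc n) * q ^ Suc n = - (w (Suc n) * (1 - q ^ Suc n))"
      by (simp add: algebra_simps del: power_Suc)
    thus ?thesis
      using q_pos by (intro iffD2[OF nonzero_eq_divide_eq]) (auto simp del: power_Suc)
  qed
  also have "\<dots> = w n / R"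
    using q_pos by (simp add: w_rec s_eq del: power_Suc)
  finally have "w (Suc n) * (1 - p ^ Suc n) = w n / R" .
  moreover have "W (Suc n) * (1 - p ^ Suc n) = w (Suc n) * (1 - p ^ Suc n) * (R * R ^ n)"
    by (simp add: W_def mult_ac)
  ultimately show ?thesis
    using R_pos by (simp add: W_def del: power_Suc)
qed

lemma g_nonneg: "0 \<le> g k"
  using N_pos[of "R * p ^ k"] node_less[of "k - 1"] node_less(2)[of k]
  by (cases k) (auto simp: g_def less_imp_le simp del: power_Suc)

lemma g_rec: "g k = (1 - p ^ k) * g (Suc k)"
proof (cases k)
  case (Suc j)
  have "N (R * p ^ k / q) = (1 - p ^ k) * N (R * p ^ k)"
    using N_div_q[of "R * p ^ k"] node_less(1)[of j] node_less(2)[of k] R_pos by (simp add: Suc)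
  moreover have "R * p ^ k / q = R * p ^ Suc k"
    by (simp add: p_def)
  moreover have "p ^ k < 1"
    using p_bounds power_Suc_less_one[of p j] by (simp add: Suc)
  ultimately show ?thesis
    by (simp add: g_def Suc del: power_Suc)
qed (simp add: g_def)

lemma g_limit: "g \<longlonglongrightarrow> 1"
proof -
  have "(\<lambda>k. 1 / N (R * p ^ k)) \<longlonglongrightarrow> 1 / N (R * 0)"
    using p_bounds R_pos
    by (intro tendsto_intros isCont_tendsto_compose[OF isCont_coh_norm] LIMSEQ_realpow_zero)
       (auto simp: radius_eq coh_norm_eq)
  moreover have "eventually (\<lambda>k. 1 / N (R * p ^ k) = g k) sequentially"
    using eventually_gt_at_top[of 0] by eventually_elim (simp add: g_def)
  ultimately show ?thesis
    by (auto simp: coh_norm_eq elim: Lim_transform_eventually)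
qed

text \<open>Discrete counterpart of \<open>nn_integral_moment\<close>. By \<open>g_rec\<close>, p^k
  g (k+1) is the increment of \<open>g\<close>: the zeroth moment telescopes to the limit 1, and
  higher ones follow by summation by parts. In the exponent, one factor p^k stems from the Jackson
  weights and n from the monomial.\<close>

lemma Jackson_moment: "(\<lambda>k. p ^ (k * Suc n) * g (Suc k)) sums (1 / W n)"
proof (induction n)
  case 0
  have "(\<lambda>k. g (Suc k) - g k) sums (1 - g 0)"
    by (rule telescope_sums[OF g_limit])
  moreover have "p ^ k * g (Suc k) = g (Suc k) - g k" for k
    using g_rec[of k] by (simp add: algebra_simps)
  ultimately show ?case by (simp add: g_def)
next
  case (Suc n)
  have "(\<lambda>k. p ^ (Suc k * Suc n) * g (Suc k)) sums (p ^ Suc n * (1 / W n))"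
    using sums_mult[OF Suc, where c = "p ^ Suc n"] by (simp only: mult_Suc power_add mult.assoc)
  \<comment> \<open>The shifted series acquires no boundary term because \<open>g 0\<close> is
    0.\<close>
  hence "(\<lambda>k. p ^ (k * Suc n) * g k) sums (p ^ Suc n * (1 / W n))"
    using sums_Suc[of "\<lambda>k. p ^ (k * Suc n) * g k"] by (simp add: g_def)
  from sums_diff[OF Suc this]
  have "(\<lambda>k. p ^ (k * Suc n) * (g (Suc k) - g k)) sums ((1 - p ^ Suc n) / W n)"
    by (simp add: right_diff_distrib diff_divide_distrib)
  moreover have "p ^ (k * Suc n) * (g (Suc k) - g k) = p ^ (k * Suc (Suc n)) * g (Suc k)" for k
  proof -
    have "g (Suc k) - g k = p ^ k * g (Suc k)"
      using g_rec[of k] by (simp add: algebra_simps)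
    thus ?thesis by (simp add: power_add mult_ac)
  qed
  moreover have "(1 - p ^ Suc n) / W n = 1 / W (Suc n)"
    using W_rec[of n] W_pos[of n] W_pos[of "Suc n"]
    by (subst frac_eq_eq) (auto simp: mult.commute simp del: power_Suc)
  ultimately show ?case by simp
qed

text \<open>The moment series has nonnegative terms, so its sum 1 / W n is at least its first term,
  which is 1 / N (R / q).\<close>

lemma W_bounded: "W n \<le> N (R / q)"
proof -
  have "(\<Sum>k<1. p ^ (k * Suc n) * g (Suc k)) \<le> (\<Sum>k. p ^ (k * Suc n) * g (Suc k))"
    using Jackson_moment[of n] p_bounds g_nonneg by (intro sum_le_suminf) (auto simp: sums_iff)
  hence "1 / N (R / q) \<le> 1 / W n"
    using Jackson_moment[of n] by (simp add: sums_iff g_def p_def)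
  moreover have "0 < N (R / q)"
    using R_pos q_gt1 by (intro N_pos) (auto simp: divide_less_eq)
  ultimately show ?thesis
    using W_pos[of n] by (simp add: divide_simps)
qed

text \<open>On a circle the bra applied to \<psi> is a series in \<open>cnj (cis \<theta>)\<close>,
  and the conjugate of the bra applied to \<phi> one in \<open>cis \<theta>\<close>, so Parseval
  keeps only equal indices. The two normalization factors multiply to 1 / N x.\<close>

lemma angular_integral:
  assumes x: "0 < x" "x < R"
  shows "(coh_angular_element q l lam \<phi> \<psi> x has_integral
    2 * pi * (\<Sum>n. cnj (coord \<phi> n) * coord \<psi> n * of_real (w n * x ^ n)) / of_real (N x)) {0..2 * pi}"
proof -
  define a where "a n = coord \<psi> n * of_real (sqrt (w n) * sqrt x ^ n)" for n
  define b where "b n = coord \<phi> n * of_real (sqrt (w n) * sqrt x ^ n)" for n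
  let ?z = "\<lambda>\<theta>. complex_of_real (sqrt x) * cis \<theta>"
  have sa: "summable (\<lambda>n. norm (a n))" and sb: "summable (\<lambda>n. norm (b n))"
    unfolding a_def b_def by (rule summable_coord_amplitude; use x in \<open>simp add: radius_eq\<close>)+
  hence sb': "summable (\<lambda>n. norm (cnj (b n)))" by simp
  have N: "0 < N x" using x by (intro N_pos) auto
  have dom: "?z \<theta> \<in> coh_domain q l lam" for \<theta>
    using x by (simp add: coh_domain_iff radius_eq norm_mult)
  have norm_z: "(cmod (?z \<theta>))\<^sup>2 = x" for \<theta>
    using x by (simp add: norm_mult)
  have ab: "cnj (b n) * a n = cnj (coord \<phi> n) * coord \<psi> n * of_real (w n * x ^ n)" for n
  proof -
    have "complex_of_real (w n * x ^ n) = of_real (sqrt (w n) * sqrt x ^ n) * of_real (sqrt (w n) * sqrt x ^ n)"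
      using x w_pos[of n] by (simp flip: of_real_mult power_mult_distrib) (simp add: less_imp_le mult_ac flip: power_mult_distrib)
    thus ?thesis by (simp add: a_def b_def)
  qed
  have angular: "coh_angular_element q l lam \<phi> \<psi> x \<theta> =
      (\<Sum>n. cnj (b n) * cis \<theta> ^ n) * (\<Sum>n. a n * cnj (cis \<theta>) ^ n) / of_real (N x)" for \<theta>
  proof -
    define X where "X = complex_of_real (N x powr (-1/2))"
    have bra: "cinner (ket (?z \<theta>)) \<eta> =
        X * (\<Sum>n. coord \<eta> n * of_real (sqrt (w n) * sqrt x ^ n) * cnj (cis \<theta>) ^ n)" for \<eta>
      unfolding cinner_coherent_state(1)[OF dom] norm_z X_def by (simp add: power_mult_distrib mult_ac)
    have "summable (\<lambda>n. b n * cnj (cis \<theta>) ^ n)"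
      by (rule summable_norm_cancel) (simp add: norm_mult norm_power sb)
    from summable_sums[OF this]
    have "(\<lambda>n. cnj (b n * cnj (cis \<theta>) ^ n)) sums cnj (\<Sum>n. b n * cnj (cis \<theta>) ^ n)"
      by (simp only: sums_cnj)
    hence "cnj (\<Sum>n. b n * cnj (cis \<theta>) ^ n) = (\<Sum>n. cnj (b n) * cis \<theta> ^ n)"
      by (simp add: sums_iff)
    moreover have "cnj X = X" by (simp add: X_def)
    ultimately have "coh_angular_element q l lam \<phi> \<psi> x \<theta> =
        X * (\<Sum>n. a n * cnj (cis \<theta>) ^ n) * (X * (\<Sum>n. cnj (b n) * cis \<theta> ^ n))"
      unfolding coh_angular_element_def cinner_ketbra bra
      by (simp only: a_def[symmetric] b_def[symmetric] complex_cnj_mult)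
    also have "\<dots> = X * X * ((\<Sum>n. cnj (b n) * cis \<theta> ^ n) * (\<Sum>n. a n * cnj (cis \<theta>) ^ n))"
      by (simp only: mult_ac)
    also have "X * X = 1 / of_real (N x)"
      using N by (simp add: X_def powr_minus inverse_eq_divide flip: of_real_mult powr_add)
    finally show ?thesis by simp
  qed
  have "((\<lambda>\<theta>. (\<Sum>n. cnj (b n) * cis \<theta> ^ n) * (\<Sum>n. a n * cnj (cis \<theta>) ^ n) / of_real (N x)) has_integral
      2 * pi * (\<Sum>n. cnj (b n) * a n) / of_real (N x)) {0..2 * pi}"
    by (intro has_integral_divide circle_Parseval sa sb')
  thus ?thesis
    unfolding ab by (simp only: angular[abs_def])
qed

text \<open>The functional equation absorbs the pole of the weight: (1 - x / R) N x equals N (x /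
  q), which is regular up to \<open>R\<close>.\<close>

lemma radial_element:
  assumes x: "0 < x" "x < R"
  shows "coh_radial_element q l lam \<phi> \<psi> x =
    (\<Sum>n. cnj (coord \<phi> n) * coord \<psi> n * of_real (w n * x ^ n)) / of_real (N (x / q))"
proof -
  have "(q - 1) * x / (l\<^sup>2 * q powr lam) = x / R"
    using q_gt1 by (simp add: R_def c_def)
  hence "1 / (2 * pi) * (1 / (1 - (q - 1) * x / (l\<^sup>2 * q powr lam))) * (2 * pi / N x) = 1 / N (x / q)"
    using N_div_q[of x] x by simp
  moreover have "complex_of_real y * (2 * pi * S / of_real (N x)) = of_real (y * (2 * pi / N x)) * S"
    for y and S :: complex
    by simp
  ultimately have "complex_of_real (1 / (2 * pi) * (1 / (1 - (q - 1) * x / (l\<^sup>2 * q powr lam)))) *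
      (2 * pi * S / of_real (N x)) = of_real (1 / N (x / q)) * S" for S :: complex
    by (simp only:)
  thus ?thesis
    unfolding coh_radial_element_def integral_unique[OF angular_integral[OF x]]
    by (simp only: of_real_divide of_real_1 times_divide_eq_left mult_1_left)
qed

lemma resolves_unity: "resolves_unity_Jackson q l lam"
proof -
  have radial: "\<exists>c'. (coh_radial_element q l lam \<phi> \<psi> \<longlongrightarrow> c') (at_left R) \<and>
      has_Jackson_integral q l lam ((coh_radial_element q l lam \<phi> \<psi>)(R := c')) (cinner \<phi> \<psi>) R"
    for \<phi> \<psi>
  proof -
    define d where "d n = cnj (coord \<phi> n) * coord \<psi> n" for n
    define D where "D x = (\<Sum>n. d n * of_real (w n * x ^ n))" for x :: real
    have sd: "summable (\<lambda>n. norm (d n))"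
      unfolding d_def using coord[of \<phi>] coord[of \<psi>]
      by (intro summable_prod_norm) (auto simp: sq_summable_def)
    have bound: "norm (d n * of_real (w n * x ^ n)) \<le> norm (d n) * N (R / q)"
      if "0 \<le> x" "x \<le> R" for n x
    proof -
      have "w n * x ^ n \<le> W n"
        unfolding W_def using that w_pos[of n] by (intro mult_left_mono power_mono) auto
      also have "\<dots> \<le> N (R / q)" by (rule W_bounded)
      finally show ?thesis
        using that w_pos[of n] by (simp add: norm_mult norm_power mult_left_mono abs_mult)
    qed
    have sbound: "summable (\<lambda>n. norm (d n) * N (R / q))"
      by (intro summable_mult2 sd)
    have sD: "summable (\<lambda>n. d n * of_real (w n * x ^ n))" if "0 \<le> x" "x \<le> R" for x
      by (rule summable_comparison_test'[OF sbound]) (rule bound[OF that])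
    have Rq: "0 < R / q" "R / q < R"
      using R_pos q_gt1 by (auto simp: divide_less_eq)
    \<comment> \<open>Boundedness of \<open>W\<close> and summability of \<open>d\<close> give a
      majorant uniform up to the boundary, where \<open>N\<close> itself diverges.\<close>
    have D_lim: "(D \<longlongrightarrow> D R) (at_left R)"
    proof -
      have "eventually (\<lambda>x. 0 < x \<and> x < R) (at_left R)"
        using eventually_at_left_real[OF R_pos] by simp
      hence ev: "eventually (\<lambda>(n, x). norm (d n * of_real (w n * x ^ n)) \<le> norm (d n) * N (R / q))
          (sequentially \<times>\<^sub>F at_left R)"
        by (rule eventually_mono[OF eventually_prodI[OF eventually_True]]) (auto intro!: bound simp del: of_real_mult of_real_power)
      have "((\<lambda>x. d n * of_real (w n * x ^ n)) \<longlongrightarrow> d n * of_real (w n * R ^ n)) (at_left R)" for n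
        by (intro tendsto_intros)
      from tannerys_theorem[OF this ev sbound] show ?thesis
        unfolding D_def by simp
    qed
    let ?c = "D R / of_real (N (R / q))"
    let ?f = "(coh_radial_element q l lam \<phi> \<psi>)(R := ?c)"
    have radial: "coh_radial_element q l lam \<phi> \<psi> x = D x / of_real (N (x / q))"
      if "0 < x" "x < R" for x
      using radial_element[OF that] by (simp add: D_def d_def)
    have "((\<lambda>x. D x / of_real (N (x / q))) \<longlongrightarrow> ?c) (at_left R)"
      using Rq N_pos[of "R / q"] q_gt1
      by (intro tendsto_intros D_lim isCont_tendsto_compose[OF isCont_coh_norm]) (auto simp: radius_eq)
    moreover have "eventually (\<lambda>x. D x / of_real (N (x / q)) = coh_radial_element q l lam \<phi> \<psi> x) (at_left R)"
      using eventually_at_left_real[OF R_pos] by eventually_elim (simp add: radial)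
    ultimately have lim: "(coh_radial_element q l lam \<phi> \<psi> \<longlongrightarrow> ?c) (at_left R)"
      by (rule Lim_transform_eventually)
    \<comment> \<open>The denominator at a node is \<open>N\<close> at the next node, hence the
      index \<open>Suc k\<close> in \<open>g\<close>. At k = 0 the left limit \<open>?c\<close>
      obeys the same formula.\<close>
    have f_node: "of_real (p ^ k) * ?f (R * p ^ k) =
        (\<Sum>n. d n * of_real (W n * (p ^ (k * Suc n) * g (Suc k))))" for k
    proof -
      have "?f (R * p ^ k) = D (R * p ^ k) / of_real (N (R * p ^ Suc k))"
      proof (cases k)
        case 0
        then show ?thesis by (simp add: p_def)
      next
        case (Suc j)
        hence "0 < R * p ^ k" "R * p ^ k < R"
          using node_less[of j] node_less(2)[of k] by auto
        then show ?thesis using radial by (simp add: p_def)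
      qed
      hence "of_real (p ^ k) * ?f (R * p ^ k) = of_real (p ^ k * g (Suc k)) * D (R * p ^ k)"
        by (simp add: g_def)
      also have "\<dots> = (\<Sum>n. of_real (p ^ k * g (Suc k)) * (d n * of_real (w n * (R * p ^ k) ^ n)))"
        unfolding D_def using node_less(2)[of k] R_pos p_bounds
        by (intro suminf_mult[symmetric] sD) (auto simp: mult_le_cancel_left1 power_le_one)
      also have "\<dots> = (\<Sum>n. d n * of_real (W n * (p ^ (k * Suc n) * g (Suc k))))"
        by (intro suminf_cong) (simp add: W_def power_mult_distrib power_add mult_ac flip: power_mult)
      finally show ?thesis .
    qed
    \<comment> \<open>Partial Jackson sum of the n-th moment, normalized to increase to 1. Its
      bounds 0 and 1 make the moduli of \<open>d n\<close> a summable majorant for letting K tend to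
      infinity inside the series over n.\<close>
    define S where "S n K = W n * (\<Sum>k<K. p ^ (k * Suc n) * g (Suc k))" for n K
    have S_lim: "(\<lambda>K. S n K) \<longlonglongrightarrow> 1" for n
    proof -
      have "(\<lambda>K. W n * (\<Sum>k<K. p ^ (k * Suc n) * g (Suc k))) \<longlonglongrightarrow> W n * (1 / W n)"
        using Jackson_moment[of n] unfolding sums_def by (intro tendsto_mult tendsto_const)
      thus ?thesis
        unfolding S_def using W_pos[of n] by simp
    qed
    have S_bound: "0 \<le> S n K" "S n K \<le> 1" for n K
    proof -
      have "(\<Sum>k<K. p ^ (k * Suc n) * g (Suc k)) \<le> 1 / W n"
        using Jackson_moment[of n] p_bounds g_nonneg
        by (subst sums_unique[OF Jackson_moment[of n]], intro sum_le_suminf) (auto simp: sums_iff)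
      thus "S n K \<le> 1"
        unfolding S_def using W_pos[of n] by (simp add: field_simps)
      show "0 \<le> S n K"
        unfolding S_def using W_pos[of n] p_bounds g_nonneg
        by (intro mult_nonneg_nonneg sum_nonneg) auto
    qed
    have term_summable: "summable (\<lambda>n. d n * of_real (W n * (p ^ (k * Suc n) * g (Suc k))))" for k
    proof (rule summable_comparison_test'[OF sd])
      fix n
      have "W n * (p ^ (k * Suc n) * g (Suc k)) \<le> S n (Suc k)"
        unfolding S_def using W_pos[of n] p_bounds g_nonneg
        by (intro mult_left_mono) (auto intro!: sum_nonneg)
      also have "\<dots> \<le> 1" by (rule S_bound)
      finally show "norm (d n * of_real (W n * (p ^ (k * Suc n) * g (Suc k)))) \<le> norm (d n)"
        using W_pos[of n] p_bounds g_nonneg[of "Suc k"]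
        by (simp add: norm_mult norm_power mult_left_le abs_mult del: mult_Suc_right)
    qed
    have "(\<lambda>K. \<Sum>n. d n * of_real (S n K)) \<longlonglongrightarrow> (\<Sum>n. d n * of_real 1)"
    proof -
      have ev: "eventually (\<lambda>(n, K). norm (d n * of_real (S n K)) \<le> norm (d n))
          (sequentially \<times>\<^sub>F sequentially)"
        using S_bound by (intro always_eventually) (auto simp: norm_mult intro!: mult_left_le)
      have "(\<lambda>K. d n * of_real (S n K)) \<longlonglongrightarrow> d n * of_real 1" for n
        by (intro tendsto_intros S_lim)
      from tannerys_theorem[OF this ev sd] show ?thesis
        by simp
    qed
    moreover have "(\<Sum>n. d n * of_real (S n K)) = (\<Sum>k<K. of_real (p ^ k) * ?f (R * p ^ k))" for K
    proof -
      have "(\<Sum>k<K. of_real (p ^ k) * ?f (R * p ^ k)) =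
          (\<Sum>n. \<Sum>k<K. d n * of_real (W n * (p ^ (k * Suc n) * g (Suc k))))"
        unfolding f_node by (intro suminf_sum[symmetric] term_summable)
      thus ?thesis
        by (simp add: S_def sum_distrib_left)
    qed
    ultimately have "(\<lambda>k. of_real (p ^ k) * ?f (R * p ^ k)) sums cinner \<phi> \<psi>"
      by (simp add: sums_def cinner_def d_def)
    moreover have "q powr (- real k) = p ^ k" for k
      using q_pos by (simp add: powr_minus powr_realpow p_def power_divide inverse_eq_divide)
    \<comment> \<open>With upper limit \<open>R\<close> the prefactor of the Jackson integral is
      exactly 1.\<close>
    moreover have "(q - 1) / (l\<^sup>2 * q powr lam) * R = 1"
      using q_gt1 l_neq by (simp add: R_def c_def)
    ultimately have "(\<lambda>k. of_real (q powr - real k) * ?f (R * q powr - real k)) sums cinner \<phi> \<psi> \<and>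
        cinner \<phi> \<psi> = of_real ((q - 1) / (l\<^sup>2 * q powr lam) * R) * cinner \<phi> \<psi>"
      by (simp only: of_real_1 mult_1_left)
    hence Jackson: "has_Jackson_integral q l lam ?f (cinner \<phi> \<psi>) R"
      unfolding has_Jackson_integral_def by (rule exI)
    show ?thesis
    proof (rule exI, rule conjI)
      show "(coh_radial_element q l lam \<phi> \<psi> \<longlongrightarrow> ?c) (at_left R)" by (rule lim)
    qed (rule Jackson)
  qed
  have angular: "coh_angular_element q l lam \<phi> \<psi> x integrable_on {0..2 * pi}"
    if "x \<in> {0<..<R}" for \<phi> \<psi> x
    using angular_integral[of x] that by auto
  show ?thesis
    unfolding resolves_unity_Jackson_def Let_def c_def[symmetric] R_def[symmetric]
    by (intro allI conjI ballI angular radial)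
qed

end

theorem proposition3p3:
  fixes q l lam :: real
  assumes "q > 0" and "q \<noteq> 1" and "l \<noteq> 0"
  shows
    "(\<forall>z\<in>coh_domain q l lam.
        coherent_state q l lam z \<in> ann_domain q l lam \<and>
        ann q l lam (coherent_state q l lam z) = z *\<^sub>C coherent_state q l lam z \<and>
        cinner (coherent_state q l lam z) (coherent_state q l lam z) = 1) \<and>
     (\<forall>z1\<in>coh_domain q l lam. \<forall>z2\<in>coh_domain q l lam. z1 \<noteq> z2 \<longrightarrow>
        (cinner (coherent_state q l lam z1) (coherent_state q l lam z2) \<noteq> 0 \<longleftrightarrow>
         \<not> (q < 1 \<and> (\<exists>k::nat. k \<ge> 1 \<and> cnj z1 * z2 =
              complex_of_real (- (l\<^sup>2 * q powr lam) / ((1 - q) * q ^ k)))))) \<and>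
     continuous_on (coh_domain q l lam) (coherent_state q l lam) \<and>
     (q < 1 \<longrightarrow> resolves_unity_Lebesgue q l lam) \<and>
     (q > 1 \<longrightarrow> resolves_unity_Jackson q l lam)"
proof -
  interpret coherent_states q l lam
    using assms by unfold_locales
  have lt1: "resolves_unity_Lebesgue q l lam" if "q < 1"
  proof -
    interpret coherent_states_lt1 q l lam
      using that by unfold_locales
    show ?thesis by (rule resolves_unity)
  qed
  have gt1: "resolves_unity_Jackson q l lam" if "q > 1"
  proof -
    interpret coherent_states_gt1 q l lam
      using that by unfold_locales
    show ?thesis by (rule resolves_unity)
  qed
  have overlap: "cinner (ket z1) (ket z2) \<noteq> 0 \<longleftrightarrow> \<not> (q < 1 \<and> (\<exists>k::nat. k \<ge> 1 \<and>
      cnj z1 * z2 = complex_of_real (- (l\<^sup>2 * q powr lam) / ((1 - q) * q ^ k))))"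
    if "z1 \<in> coh_domain q l lam" "z2 \<in> coh_domain q l lam" for z1 z2
    using coherent_state_orthogonal_iff[OF that] unfolding c_def by (rule arg_cong[where f = Not])
  show ?thesis
    by (intro conjI ballI impI;
        (rule coherent_state_eigenvector coherent_state_normalized overlap
          continuous_on_coherent_state lt1 gt1; assumption)?)
qed

end
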